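(* Let $\{a_n\}$ be a $6$-periodic sequence of positive numbers of primitive period $6$, with $(a_1,\dots,a_6)=(a,b,c,d,e,f)$. Then the recurrence $x_{n+2}=\frac{a_n+x_{n+1}}{x_n}$ is persistent. Moreover, if $(a,b,c,d,e,f)\in\mathbf{P}_{f,e,d,c,b,a}$, then any sequence $\{x_n\}$ generated by the recurrence with positive initial conditions is either periodic, with period a multiple of $6$, or it densely fills at most $6$ disjoint intervals of $\mathbb{R}^+$.
   Context: The set $\mathbf{P}_{f,e,d,c,b,a}$ consists of the $(a,b,c,d,e,f)\in(\mathbb{R}^+)^6$ such that the system $$y^2=\frac{(f+x)(a+bx)}{dx+e},\qquad x^2=\frac{(a+y)(f+ey)}{b+cy}$$ has a unique solution $(x,y)$ in $Q^+=\{(x,y):x>0,y>0\}$. The recurrence is persistent if for any sequence $\{x_n\}$ generated from positive initial conditions there exist constants $c_0,C_0>0$, depending on the initial conditions, with $c_0<x_n<C_0$ for all $n$. A sequence densely fills at most $6$ disjoint intervals if its set of values is a dense subset of a union of at most $6$ disjoint intervals. *)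

theory Defs
  imports "HOL-Analysis.Analysis"
begin

text \<open>Sequences are indexed by the positive integers; the value at index 0 is never used.\<close>

definition has_period :: "(nat \<Rightarrow> real) \<Rightarrow> nat \<Rightarrow> bool" where
  "has_period s p \<longleftrightarrow> p > 0 \<and> (\<forall>n\<ge>1. s (n + p) = s n)"

definition has_primitive_period :: "(nat \<Rightarrow> real) \<Rightarrow> nat \<Rightarrow> bool" where
  "has_primitive_period s p \<longleftrightarrow> has_period s p \<and> (\<forall>q. has_period s q \<longrightarrow> p \<le> q)"

definition lyness_sequence :: "(nat \<Rightarrow> real) \<Rightarrow> (nat \<Rightarrow> real) \<Rightarrow> bool" where
  "lyness_sequence s x \<longleftrightarrow>
     x 1 > 0 \<and> x 2 > 0 \<and> (\<forall>n\<ge>1. x (n + 2) = (s n + x (n + 1)) / x n)"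

definition persistent :: "(nat \<Rightarrow> real) \<Rightarrow> bool" where
  "persistent s \<longleftrightarrow>
     (\<forall>x. lyness_sequence s x \<longrightarrow> (\<exists>c0 C0. 0 < c0 \<and> 0 < C0 \<and> (\<forall>n\<ge>1. c0 < x n \<and> x n < C0)))"

definition P_fedcba :: "(real \<times> real \<times> real \<times> real \<times> real \<times> real) set" where
  "P_fedcba = {(a, b, c, d, e, f).
     a > 0 \<and> b > 0 \<and> c > 0 \<and> d > 0 \<and> e > 0 \<and> f > 0 \<and>
     (\<exists>!(x, y). x > 0 \<and> y > 0 \<and>
        y\<^sup>2 = ((f + x) * (a + b * x)) / (d * x + e) \<and>
        x\<^sup>2 = ((a + y) * (f + e * y)) / (b + c * y))}"

text \<open>
  Intervals are required to be nondegenerate: if single points were admitted, every sequence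
  with at most \<open>k\<close> values would qualify.
\<close>

definition densely_fills_intervals :: "nat \<Rightarrow> (nat \<Rightarrow> real) \<Rightarrow> bool" where
  "densely_fills_intervals k x \<longleftrightarrow>
     (\<exists>\<I>. finite \<I> \<and> card \<I> \<le> k \<and> disjoint \<I> \<and>
        (\<forall>J\<in>\<I>. is_interval J \<and> interior J \<noteq> {} \<and> J \<subseteq> {0<..}) \<and>
        x ` {1..} \<subseteq> \<Union>\<I> \<and> \<Union>\<I> \<subseteq> closure (x ` {1..}))"

end

theory Submission
  imports Defs "HOL-Computational_Algebra.Polynomial"
begin

text \<open>
  The recurrence is iteration of the planar maps \<open>F\<^sub>n (x, y) = (y, (s\<^sub>n + y)/x)\<close> on the open quadrant.
  For coefficients of period six these maps have a common first integral: with
  \<open>(a, \<dots>, f)\<close> the six coefficients starting at \<open>s\<^sub>n\<close>, the function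
  \<open>V = a f/(x y) + (a + b f)/y + (f + a e)/x + b x/y + e y/x + c x + d y\<close> at \<open>(x\<^sub>n, x\<^sub>n\<^sub>+\<^sub>1)\<close>
  does not depend on \<open>n\<close> (\<open>lyness_cubic_step\<close>). It tends to infinity at the boundary of the quadrant
  and at infinity, and persistence follows (\<open>persistent_period_6\<close>).

  The system defining \<open>P_fedcba\<close> says that \<open>V\<close> has exactly one critical point. Minimizing \<open>V\<close> over
  \<open>y\<close> gives a function of \<open>x\<close> that falls to its minimum and then rises, so each level of \<open>V\<close> above
  the minimum is a single smooth oval, met twice by the vertical lines over an open interval of \<open>x\<close>
  and by no others except the two tangents at its ends. The oval is one periodic orbit
  of the Hamiltonian field of \<open>V\<close> for the area form \<open>dx dy/(x y)\<close> (\<open>oval_orbit\<close>).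

  Each \<open>F\<^sub>n\<close> preserves this area form and the integral, hence maps Hamiltonian orbits to Hamiltonian
  orbits (\<open>hamiltonian_orbit_step\<close>), and orbits with a common value at one time are equal
  (\<open>hamiltonian_orbit_unique\<close>). Six steps therefore act on the oval as a translation of the time
  parameter, that is, as a rotation of a circle (\<open>orbit_dichotomy\<close>). A rational rotation makes every
  solution on the level periodic. Under an irrational rotation, Kronecker's theorem makes each of the
  six subsequences \<open>x\<^sub>6\<^sub>m\<^sub>+\<^sub>i\<close> dense in the projection of an oval, which is a nondegenerate interval;
  the six projections unite to at most six disjoint intervals. At the minimal level the solution has
  period six. Finally, a period of a solution is a period of the coefficients, hence a multiple of six.
\<close>

section \<open>The first integral of the period-six recurrence\<close>

text \<open>
  This is \<open>x y (V(x,y) - h)\<close> with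
  \<open>V = a f/(x y) + (a + b f)/y + (f + a e)/x + b x/y + e y/x + c x + d y\<close>.
  On the open quadrant its zero set is the level set \<open>V = h\<close>; clearing denominators makes every
  identity below a polynomial one.
\<close>

definition lyness_cubic ::
  "real \<Rightarrow> real \<Rightarrow> real \<Rightarrow> real \<Rightarrow> real \<Rightarrow> real \<Rightarrow> real \<Rightarrow> real \<Rightarrow> real \<Rightarrow> real" where
  "lyness_cubic a b c d e f h x y =
     (e + d * x) * y\<^sup>2 + (f + a * e + c * x\<^sup>2 - h * x) * y + (f + x) * (a + b * x)"

definition lyness_cubic_dx ::
  "real \<Rightarrow> real \<Rightarrow> real \<Rightarrow> real \<Rightarrow> real \<Rightarrow> real \<Rightarrow> real \<Rightarrow> real \<Rightarrow> real \<Rightarrow> real" where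
  "lyness_cubic_dx a b c d e f h x y =
     d * y\<^sup>2 + (2 * c * x - h) * y + (a + b * f + 2 * b * x)"

definition lyness_cubic_dy ::
  "real \<Rightarrow> real \<Rightarrow> real \<Rightarrow> real \<Rightarrow> real \<Rightarrow> real \<Rightarrow> real \<Rightarrow> real \<Rightarrow> real \<Rightarrow> real" where
  "lyness_cubic_dy a b c d e f h x y =
     2 * (e + d * x) * y + (f + a * e + c * x\<^sup>2 - h * x)"

text \<open>
  Invariance of \<open>V\<close>: one step of the recurrence rotates the coefficients cyclically and keeps the
  level. With period six the rotated six-tuple is again the window of coefficients seen by the next
  pair, so \<open>h\<close> is an invariant of the whole sequence.
\<close>

lemma lyness_cubic_step:
  assumes "x > 0" and "lyness_cubic a b c d e f h x y = 0"
  shows "lyness_cubic b c d e f a h y ((a + y) / x) = 0"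
proof -
  define w where "w = (a + y) / x"
  have w: "x * w = a + y" using assms by (simp add: w_def)
  have "x\<^sup>2 * lyness_cubic b c d e f a h y w
      = (f + e * y) * (x * w)\<^sup>2 + (a + b * f + d * y\<^sup>2 - h * y) * x * (x * w)
        + x\<^sup>2 * ((a + y) * (b + c * y))"
    unfolding lyness_cubic_def by algebra
  also have "\<dots> = (a + y) * lyness_cubic a b c d e f h x y"
    unfolding w lyness_cubic_def by algebra
  finally show ?thesis using assms by (simp add: w_def)
qed

text \<open>
  The step maps \<open>(x, y)\<close> to \<open>(y, (a + y)/x)\<close> and preserves the area form
  \<open>dx dy / (x y)\<close>, as well as \<open>V\<close> up to rotation of the coefficients. It therefore carries the
  vector field \<open>(- \<partial>P/\<partial>y, \<partial>P/\<partial>x)\<close> of a level cubic \<open>P\<close> to the one of the next level cubic.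
  This lemma and the next are the two components of that statement.
\<close>

lemma lyness_cubic_dx_step:
  assumes "x > 0" and "lyness_cubic a b c d e f h x y = 0"
  shows "lyness_cubic_dx a b c d e f h x y
       = - lyness_cubic_dy b c d e f a h y ((a + y) / x)"
proof -
  define w where "w = (a + y) / x"
  have w: "x * w = a + y" using assms by (simp add: w_def)
  have "x * (lyness_cubic_dx a b c d e f h x y + lyness_cubic_dy b c d e f a h y w)
     = x * lyness_cubic_dx a b c d e f h x y + 2 * (f + e * y) * (x * w)
       + x * (a + b * f + d * y\<^sup>2 - h * y)"
    unfolding lyness_cubic_dy_def by algebra
  also have "\<dots> = 2 * lyness_cubic a b c d e f h x y"
    unfolding w lyness_cubic_def lyness_cubic_dx_def by algebra
  finally show ?thesis using assms by (simp add: w_def)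
qed

lemma lyness_cubic_dy_step:
  assumes "x > 0" and "lyness_cubic a b c d e f h x y = 0"
  shows "(lyness_cubic_dx a b c d e f h x y * x + (a + y) * lyness_cubic_dy a b c d e f h x y) / x\<^sup>2
       = lyness_cubic_dx b c d e f a h y ((a + y) / x)"
proof -
  define w where "w = (a + y) / x"
  have w: "x * w = a + y" using assms by (simp add: w_def)
  have "x\<^sup>2 * lyness_cubic_dx b c d e f a h y w
     = e * (x * w)\<^sup>2 + (2 * d * y - h) * x * (x * w) + x\<^sup>2 * (b + c * a + 2 * c * y)"
    unfolding lyness_cubic_dx_def by algebra
  also have "\<dots> = lyness_cubic_dx a b c d e f h x y * x
      + (a + y) * lyness_cubic_dy a b c d e f h x y
      - lyness_cubic a b c d e f h x y"
    unfolding w lyness_cubic_def lyness_cubic_dx_def lyness_cubic_dy_def by algebra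
  finally show ?thesis using assms by (simp add: w_def field_simps)
qed

lemma lyness_cubic_level_bounds:
  assumes "a > 0" "b > 0" "c > 0" "d > 0" "e > 0" "f > 0" "x > 0" "y > 0"
    and "lyness_cubic a b c d e f h x y = 0"
  shows "h > 0" "f < h * x" "c * x < h" "d * y < h"
proof -
  have *: "h * (x * y) = e * y\<^sup>2 + d * x * y\<^sup>2 + f * y + a * e * y + c * x\<^sup>2 * y + (f + x) * (a + b * x)"
    using assms(9) unfolding lyness_cubic_def by algebra
  have p: "e * y\<^sup>2 > 0" "d * x * y\<^sup>2 > 0" "f * y > 0" "a * e * y > 0" "c * x\<^sup>2 * y > 0"
      "(f + x) * (a + b * x) > 0"
    using assms by (auto intro!: mult_pos_pos add_pos_pos)
  have "0 < h * (x * y)" using * p by linarith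
  then show "h > 0" using zero_less_mult_pos2 mult_pos_pos[OF assms(7,8)] by blast
  have "f * y < (h * x) * y" using * p by (simp add: mult.assoc)
  then show "f < h * x" using assms by simp
  have "(c * x) * (x * y) < h * (x * y)" using * p by (simp add: power2_eq_square algebra_simps)
  then show "c * x < h" using assms by (simp add: mult_less_cancel_right)
  have "(d * y) * (x * y) < h * (x * y)" using * p by (simp add: power2_eq_square algebra_simps)
  then show "d * y < h" using assms by (simp add: mult_less_cancel_right)
qed

section \<open>Hamiltonian motion on the level curves\<close>

text \<open>
  Motion along the level curve under the Hamiltonian field of the polynomial \<open>P = x y (V - h)\<close>. On the
  curve it agrees with the Hamiltonian field of \<open>V\<close> for the area form \<open>dx dy / (x y)\<close>, and it has
  the advantage of being polynomial.
\<close>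

definition hamiltonian_orbit ::
  "real \<Rightarrow> real \<Rightarrow> real \<Rightarrow> real \<Rightarrow> real \<Rightarrow> real \<Rightarrow> real \<Rightarrow> (real \<Rightarrow> real) \<Rightarrow> (real \<Rightarrow> real) \<Rightarrow> bool" where
  "hamiltonian_orbit a b c d e f h u v \<longleftrightarrow>
     (\<forall>t. u t > 0 \<and> v t > 0 \<and> lyness_cubic a b c d e f h (u t) (v t) = 0 \<and>
        (u has_real_derivative - lyness_cubic_dy a b c d e f h (u t) (v t)) (at t) \<and>
        (v has_real_derivative lyness_cubic_dx a b c d e f h (u t) (v t)) (at t))"

lemma hamiltonian_orbit_step:
  assumes "a > 0" and orb: "hamiltonian_orbit a b c d e f h u v"
  shows "hamiltonian_orbit b c d e f a h v (\<lambda>t. (a + v t) / u t)"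
  unfolding hamiltonian_orbit_def
proof (intro allI conjI)
  fix t
  have pos: "u t > 0" "v t > 0" and z: "lyness_cubic a b c d e f h (u t) (v t) = 0"
    and du: "(u has_real_derivative - lyness_cubic_dy a b c d e f h (u t) (v t)) (at t)"
    and dv: "(v has_real_derivative lyness_cubic_dx a b c d e f h (u t) (v t)) (at t)"
    using orb by (auto simp: hamiltonian_orbit_def)
  show "v t > 0" "(a + v t) / u t > 0" using pos assms by auto
  show "lyness_cubic b c d e f a h (v t) ((a + v t) / u t) = 0"
    using lyness_cubic_step[OF pos(1) z] .
  show "(v has_real_derivative - lyness_cubic_dy b c d e f a h (v t) ((a + v t) / u t)) (at t)"
    using dv lyness_cubic_dx_step[OF pos(1) z] by simp
  have "((\<lambda>t. (a + v t) / u t) has_real_derivative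
      ((0 + lyness_cubic_dx a b c d e f h (u t) (v t)) * u t
        - (a + v t) * (- lyness_cubic_dy a b c d e f h (u t) (v t))) / (u t * u t)) (at t)"
    by (intro DERIV_divide DERIV_add DERIV_const du dv) (use pos in auto)
  then show "((\<lambda>t. (a + v t) / u t) has_real_derivative
      lyness_cubic_dx b c d e f a h (v t) ((a + v t) / u t)) (at t)"
    using lyness_cubic_dy_step[OF pos(1) z] by (simp add: power2_eq_square)
qed

text \<open>
  Gronwall's argument in both time directions: with all coefficients bounded by \<open>L\<close>, the squared length
  \<open>E = p\<^sup>2 + q\<^sup>2\<close> satisfies \<open>\<bar>E'\<bar> \<le> 4 L E\<close>, so it vanishes throughout once it vanishes at \<open>s\<close>.
\<close>

lemma linear_system_zero:
  fixes p q :: "real \<Rightarrow> real"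
  assumes p: "\<And>t. (p has_real_derivative A t * p t + B t * q t) (at t)"
    and q: "\<And>t. (q has_real_derivative C t * p t + D t * q t) (at t)"
    and bd: "\<And>t. \<bar>A t\<bar> \<le> L" "\<And>t. \<bar>B t\<bar> \<le> L" "\<And>t. \<bar>C t\<bar> \<le> L" "\<And>t. \<bar>D t\<bar> \<le> L"
    and zero: "p s = 0" "q s = 0"
  shows "p t = 0 \<and> q t = 0"
proof -
  define E where "E t = (p t)\<^sup>2 + (q t)\<^sup>2" for t
  define E' where "E' t = 2 * p t * (A t * p t + B t * q t) + 2 * q t * (C t * p t + D t * q t)" for t
  have dE: "(E has_real_derivative E' t) (at t)" for t
    unfolding E_def E'_def by (auto intro!: derivative_eq_intros p q)
  have bE: "\<bar>E' t\<bar> \<le> 4 * L * E t" for t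
  proof -
    have pq: "2 * \<bar>p t * q t\<bar> \<le> E t"
      using sum_squares_bound[of "\<bar>p t\<bar>" "\<bar>q t\<bar>"] by (simp add: E_def abs_mult)
    have "\<bar>E' t\<bar> \<le> \<bar>A t * (2 * (p t)\<^sup>2)\<bar> + \<bar>(B t + C t) * (2 * (p t * q t))\<bar> + \<bar>D t * (2 * (q t)\<^sup>2)\<bar>"
    proof -
      have "E' t = A t * (2 * (p t)\<^sup>2) + (B t + C t) * (2 * (p t * q t)) + D t * (2 * (q t)\<^sup>2)"
        unfolding E'_def by algebra
      then show ?thesis by linarith
    qed
    also have "\<dots> \<le> L * (2 * (p t)\<^sup>2) + (2 * L) * E t + L * (2 * (q t)\<^sup>2)"
    proof (intro add_mono)
      show "\<bar>A t * (2 * (p t)\<^sup>2)\<bar> \<le> L * (2 * (p t)\<^sup>2)" "\<bar>D t * (2 * (q t)\<^sup>2)\<bar> \<le> L * (2 * (q t)\<^sup>2)"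
        using bd by (auto simp: abs_mult intro!: mult_right_mono)
      have "\<bar>B t + C t\<bar> \<le> 2 * L" using bd(2,3)[of t] by linarith
      then show "\<bar>(B t + C t) * (2 * (p t * q t))\<bar> \<le> 2 * L * E t"
        unfolding abs_mult[of "B t + C t"] using pq by (intro mult_mono) (auto simp: abs_mult)
    qed
    also have "\<dots> = 4 * L * E t" by (simp add: E_def algebra_simps)
    finally show ?thesis .
  qed
  have Es: "E s = 0" using zero by (simp add: E_def)
  have "E t \<le> 0"
  proof (cases "s \<le> t")
    case True
    have "exp (- (4 * L * t)) * E t \<le> exp (- (4 * L * s)) * E s"
    proof (rule DERIV_nonpos_imp_nonincreasing[OF True])
      fix x
      have "((\<lambda>t. exp (- (4 * L * t)) * E t) has_real_derivative
          exp (- (4 * L * x)) * (E' x - 4 * L * E x)) (at x)"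
        by (auto intro!: derivative_eq_intros dE simp: algebra_simps)
      moreover have "exp (- (4 * L * x)) * (E' x - 4 * L * E x) \<le> 0"
        using bE[of x] by (intro mult_nonneg_nonpos) auto
      ultimately show "\<exists>y. ((\<lambda>t. exp (- (4 * L * t)) * E t) has_real_derivative y) (at x) \<and> y \<le> 0"
        by blast
    qed
    then show ?thesis by (simp add: Es mult_le_0_iff)
  next
    case False
    then have "t \<le> s" by simp
    have "exp (4 * L * t) * E t \<le> exp (4 * L * s) * E s"
    proof (rule DERIV_nonneg_imp_nondecreasing[OF \<open>t \<le> s\<close>])
      fix x
      have "((\<lambda>t. exp (4 * L * t) * E t) has_real_derivative
          exp (4 * L * x) * (E' x + 4 * L * E x)) (at x)"
        by (auto intro!: derivative_eq_intros dE simp: algebra_simps)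
      moreover have "exp (4 * L * x) * (E' x + 4 * L * E x) \<ge> 0"
        using bE[of x] by (intro mult_nonneg_nonneg) auto
      ultimately show "\<exists>y. ((\<lambda>t. exp (4 * L * t) * E t) has_real_derivative y) (at x) \<and> 0 \<le> y"
        by blast
    qed
    then show ?thesis by (simp add: Es mult_le_0_iff)
  qed
  then show ?thesis unfolding E_def by (simp add: sum_power2_le_zero_iff)
qed

text \<open>
  The difference of two orbits solves a linear system. Its coefficients are bounded because a level
  curve lies in the box \<open>0 < x < h/c\<close>, \<open>0 < y < h/d\<close>.
\<close>

lemma hamiltonian_orbit_unique:
  assumes pos: "a > 0" "b > 0" "c > 0" "d > 0" "e > 0" "f > 0"
    and o1: "hamiltonian_orbit a b c d e f h u1 v1"
    and o2: "hamiltonian_orbit a b c d e f h u2 v2"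
    and eq: "u1 s = u2 s" "v1 s = v2 s"
  shows "u1 t = u2 t \<and> v1 t = v2 t"
proof -
  have bd: "h > 0 \<and> 0 < u t \<and> c * u t \<le> h \<and> u t \<le> h / c \<and> 0 < v t \<and> d * v t \<le> h \<and> v t \<le> h / d"
    if "hamiltonian_orbit a b c d e f h u v" for u v t
  proof -
    have *: "u t > 0" "v t > 0" "lyness_cubic a b c d e f h (u t) (v t) = 0"
      using that by (auto simp: hamiltonian_orbit_def)
    show ?thesis
      using lyness_cubic_level_bounds[OF pos *] * pos by (auto simp: field_simps)
  qed
  have der: "(u has_real_derivative - lyness_cubic_dy a b c d e f h (u t) (v t)) (at t)"
      "(v has_real_derivative lyness_cubic_dx a b c d e f h (u t) (v t)) (at t)"
    if "hamiltonian_orbit a b c d e f h u v" for u v t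
    using that by (auto simp: hamiltonian_orbit_def)
  define L where "L = 5 * h + 2 * e + 2 * b + 2 * d * (h / c) + 2 * c * (h / d)"
  have "u1 t - u2 t = 0 \<and> v1 t - v2 t = 0"
  proof (rule linear_system_zero[where p = "\<lambda>t. u1 t - u2 t" and q = "\<lambda>t. v1 t - v2 t" and s = s
        and L = L and A = "\<lambda>t. h - 2 * d * v2 t - c * (u1 t + u2 t)"
        and B = "\<lambda>t. - (2 * e + 2 * d * u1 t)" and C = "\<lambda>t. 2 * c * v2 t + 2 * b"
        and D = "\<lambda>t. d * (v1 t + v2 t) + 2 * c * u1 t - h"])
    fix t
    show "((\<lambda>t. u1 t - u2 t) has_real_derivative
        (h - 2 * d * v2 t - c * (u1 t + u2 t)) * (u1 t - u2 t)
        + (- (2 * e + 2 * d * u1 t)) * (v1 t - v2 t)) (at t)"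
      by (rule DERIV_cong, rule DERIV_diff[OF der(1)[OF o1] der(1)[OF o2]])
         (simp add: lyness_cubic_dy_def power2_eq_square algebra_simps)
    show "((\<lambda>t. v1 t - v2 t) has_real_derivative
        (2 * c * v2 t + 2 * b) * (u1 t - u2 t)
        + (d * (v1 t + v2 t) + 2 * c * u1 t - h) * (v1 t - v2 t)) (at t)"
      by (rule DERIV_cong, rule DERIV_diff[OF der(2)[OF o1] der(2)[OF o2]])
         (simp add: lyness_cubic_dx_def power2_eq_square algebra_simps)
    note b1 = bd[OF o1, of t] and b2 = bd[OF o2, of t]
    have m: "0 < c * u1 t" "0 < c * u2 t" "0 < d * v1 t" "0 < d * v2 t" "0 < d * u1 t" "0 < c * v2 t"
      using b1 b2 pos by auto
    have M: "d * u1 t \<le> d * (h / c)" "c * v2 t \<le> c * (h / d)"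
      using b1 b2 pos by (meson less_imp_le mult_left_mono)+
    show "\<bar>h - 2 * d * v2 t - c * (u1 t + u2 t)\<bar> \<le> L" "\<bar>- (2 * e + 2 * d * u1 t)\<bar> \<le> L"
      "\<bar>2 * c * v2 t + 2 * b\<bar> \<le> L" "\<bar>d * (v1 t + v2 t) + 2 * c * u1 t - h\<bar> \<le> L"
      using b1 b2 m M pos unfolding L_def abs_le_iff distrib_left mult.assoc by linarith+
  qed (use eq in auto)
  then show ?thesis by simp
qed

section \<open>Valley-shaped functions, simple roots and periodic scalar flows\<close>

text \<open>
  If the derivative had the wrong sign somewhere, say left of \<open>p\<close>, then the function would have a
  higher value further left and lower values just left of the point, hence an interior minimum strictly
  left of \<open>p\<close>, which is a second critical point.
\<close>

lemma valley_deriv_sign: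
  fixes \<phi> \<phi>' :: "real \<Rightarrow> real"
  assumes der: "\<And>x. x > 0 \<Longrightarrow> (\<phi> has_real_derivative \<phi>' x) (at x)"
    and crit: "\<And>x. x > 0 \<Longrightarrow> \<phi>' x = 0 \<Longrightarrow> x = p"
    and low: "\<And>x M. x > 0 \<Longrightarrow> \<exists>y. 0 < y \<and> y < x \<and> \<phi> y > M"
    and high: "\<And>x M. x > 0 \<Longrightarrow> \<exists>y. x < y \<and> \<phi> y > M"
    and x: "x > 0"
  shows "x < p \<Longrightarrow> \<phi>' x < 0" "p < x \<Longrightarrow> \<phi>' x > 0"
proof -
  have cont: "continuous_on {u..v} \<phi>" if "u > 0" for u v
    using that by (auto intro!: continuous_at_imp_continuous_on DERIV_isCont[OF der])
  show "\<phi>' x < 0" if "x < p"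
  proof (rule ccontr)
    assume "\<not> \<phi>' x < 0"
    then have pos: "\<phi>' x > 0" using crit[OF x] that by force
    obtain y where y: "0 < y" "y < x" "\<phi> y > \<phi> x" using low[OF x] by blast
    obtain z where z: "z \<in> {y..x}" "\<And>w. w \<in> {y..x} \<Longrightarrow> \<phi> z \<le> \<phi> w"
      using continuous_attains_inf[of "{y..x}" \<phi>] cont[OF y(1)] y by auto
    have "z \<noteq> y" using z(2)[of x] y by auto
    moreover have "z \<noteq> x"
    proof
      assume "z = x"
      obtain \<delta> where \<delta>: "\<delta> > 0" "\<And>r. 0 < r \<Longrightarrow> r < \<delta> \<Longrightarrow> \<phi> (x - r) < \<phi> x"
        using DERIV_pos_inc_left[OF der[OF x] pos] by blast
      define r where "r = min (\<delta> / 2) (x - y)"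
      have "0 < r" "r < \<delta>" "x - r \<in> {y..x}" using \<delta>(1) y by (auto simp: r_def min_def)
      then show False using \<delta>(2)[of r] z(2)[of "x - r"] \<open>z = x\<close> by auto
    qed
    ultimately have zin: "y < z" "z < x" using z(1) by auto
    have "\<phi>' z = 0"
    proof (rule DERIV_local_min[OF der, of z "min (z - y) (x - z)"])
      show "\<forall>w. \<bar>z - w\<bar> < min (z - y) (x - z) \<longrightarrow> \<phi> z \<le> \<phi> w"
        by (auto intro!: z(2))
    qed (use zin y in auto)
    then have "z = p" using crit zin y by auto
    then show False using zin that by simp
  qed
  show "\<phi>' x > 0" if "p < x"
  proof (rule ccontr)
    assume "\<not> \<phi>' x > 0"
    then have neg: "\<phi>' x < 0" using crit[OF x] that by force
    obtain y where y: "x < y" "\<phi> y > \<phi> x" using high[OF x] by blast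
    obtain z where z: "z \<in> {x..y}" "\<And>w. w \<in> {x..y} \<Longrightarrow> \<phi> z \<le> \<phi> w"
      using continuous_attains_inf[of "{x..y}" \<phi>] cont[OF x] y by auto
    have "z \<noteq> y" using z(2)[of x] y by auto
    moreover have "z \<noteq> x"
    proof
      assume "z = x"
      obtain \<delta> where \<delta>: "\<delta> > 0" "\<And>r. 0 < r \<Longrightarrow> r < \<delta> \<Longrightarrow> \<phi> (x + r) < \<phi> x"
        using DERIV_neg_dec_right[OF der[OF x] neg] by blast
      define r where "r = min (\<delta> / 2) (y - x)"
      have "0 < r" "r < \<delta>" "x + r \<in> {x..y}" using \<delta>(1) y by (auto simp: r_def min_def)
      then show False using \<delta>(2)[of r] z(2)[of "x + r"] \<open>z = x\<close> by auto
    qed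
    ultimately have zin: "x < z" "z < y" using z(1) by auto
    have "\<phi>' z = 0"
    proof (rule DERIV_local_min[OF der, of z "min (z - x) (y - z)"])
      show "\<forall>w. \<bar>z - w\<bar> < min (z - x) (y - z) \<longrightarrow> \<phi> z \<le> \<phi> w"
        by (auto intro!: z(2))
    qed (use zin x in auto)
    then have "z = p" using crit zin x by auto
    then show False using zin that by simp
  qed
qed

text \<open>
  The quotient is positive inside because \<open>D\<close> is, nonnegative at the ends by continuity, and nonzero
  there because the roots are simple.
\<close>

lemma poly_factor_two_roots:
  fixes D :: "real poly"
  assumes "poly D \<alpha> = 0" "poly D \<beta> = 0" "\<alpha> < \<beta>"
    and inner: "\<And>x. \<alpha> < x \<Longrightarrow> x < \<beta> \<Longrightarrow> poly D x > 0"
    and simple: "poly (pderiv D) \<alpha> \<noteq> 0" "poly (pderiv D) \<beta> \<noteq> 0"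
  obtains R where "\<And>x. poly D x = (x - \<alpha>) * (\<beta> - x) * poly R x"
    and "\<And>x. poly (pderiv D) x =
      (\<alpha> + \<beta> - 2 * x) * poly R x + (x - \<alpha>) * (\<beta> - x) * poly (pderiv R) x"
    and "\<And>x. \<alpha> \<le> x \<Longrightarrow> x \<le> \<beta> \<Longrightarrow> poly R x > 0"
proof -
  obtain Q where Q: "D = [:-\<alpha>, 1:] * Q"
    using assms(1) by (auto simp: poly_eq_0_iff_dvd elim: dvdE)
  have "poly Q \<beta> = 0" using assms(2,3) by (simp add: Q)
  then obtain Q' where Q': "Q = [:-\<beta>, 1:] * Q'" by (auto simp: poly_eq_0_iff_dvd elim: dvdE)
  define R where "R = - Q'"
  have D: "D = [:-\<alpha>, 1:] * [:\<beta>, -1:] * R"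
    unfolding Q Q' R_def
    by (intro poly_eqI_degree[where A=UNIV] poly_eq_poly_eq_iff[THEN iffD1] ext) (simp add: algebra_simps)
  have ev: "poly D x = (x - \<alpha>) * (\<beta> - x) * poly R x" for x
    by (simp add: D algebra_simps)
  have dev: "poly (pderiv D) x = (\<alpha> + \<beta> - 2 * x) * poly R x + (x - \<alpha>) * (\<beta> - x) * poly (pderiv R) x" for x
    by (simp only: D pderiv_mult) (simp add: pderiv_pCons algebra_simps)
  have inner': "poly R x > 0" if "\<alpha> < x" "x < \<beta>" for x
    using inner[OF that] zero_less_mult_pos[of "(x - \<alpha>) * (\<beta> - x)" "poly R x"] that by (simp add: ev)
  have ge: "poly R x \<ge> 0" if x: "x \<in> {\<alpha>..\<beta>}" for x
  proof -
    have "closure {\<alpha><..<\<beta>} \<subseteq> {x. poly R x \<ge> 0}"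
    proof (rule closure_minimal)
      show "{\<alpha><..<\<beta>} \<subseteq> {x. poly R x \<ge> 0}" using inner' by (auto intro: less_imp_le)
      show "closed {x. poly R x \<ge> 0}" by (intro closed_Collect_le continuous_intros)
    qed
    then show ?thesis using x assms(3) by auto
  qed
  have "poly R \<alpha> \<noteq> 0" "poly R \<beta> \<noteq> 0" using simple by (auto simp: dev)
  then have "poly R x > 0" if "\<alpha> \<le> x" "x \<le> \<beta>" for x
    using that inner'[of x] ge[of x] assms(3) by (cases "x = \<alpha> \<or> x = \<beta>") (auto simp: order_less_le)
  then show thesis using that ev dev by blast
qed

text \<open>
  A global solution of \<open>\<theta>' = w(\<theta>)\<close> is the inverse of an antiderivative \<open>F\<close> of
  \<open>1/w\<close>. Periodicity of \<open>w\<close> makes \<open>F\<close> increase by the same amount \<open>T\<close> over every period,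
  which gives both surjectivity and the period of the solution.
\<close>

lemma periodic_scalar_flow:
  fixes w :: "real \<Rightarrow> real"
  assumes cont: "\<And>x. isCont w x" and pos: "\<And>x. w x > 0"
    and per: "\<And>x. w (x + P) = w x" and P: "P > 0"
  obtains \<theta> T where "T > 0" and "\<And>t. (\<theta> has_real_derivative w (\<theta> t)) (at t)"
    and "\<And>t. \<theta> (t + T) = \<theta> t + P" and "surj \<theta>"
proof -
  have "\<And>x. isCont (\<lambda>x. inverse (w x)) x"
    using cont pos by (intro continuous_intros) (auto simp: less_imp_neq[THEN not_sym])
  then obtain F where F: "\<And>x. (F has_real_derivative inverse (w x)) (at x)"
    using einterval_antiderivative[of "-\<infinity>" "\<infinity>" "\<lambda>x. inverse (w x)"]
    by (auto simp: has_real_derivative_iff_has_vector_derivative)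
  have mono: "strict_mono F"
  proof (rule strict_monoI)
    fix x y :: real assume "x < y"
    then show "F x < F y"
      using DERIV_pos_imp_increasing[OF \<open>x < y\<close>] F pos by (metis positive_imp_inverse_positive)
  qed
  have Fper: "F (x + P) - F x = F P - F 0" for x
  proof -
    have "((\<lambda>x. F (x + P) - F x) has_real_derivative 0) (at x)" for x
      using DERIV_diff[OF DERIV_shift[THEN iffD1, OF F[of "x + P"]] F[of x]] by (simp add: per)
    then show ?thesis using DERIV_isconst_all[of "\<lambda>x. F (x + P) - F x" x 0] by simp
  qed
  define T where "T = F P - F 0"
  have T: "T > 0" using strict_monoD[OF mono P] by (simp add: T_def)
  have Fk: "F (x + real k * P) = F x + real k * T" for x k
  proof (induction k)
    case (Suc k)
    have "F (x + real (Suc k) * P) = F ((x + real k * P) + P)" by (simp add: algebra_simps)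
    also have "\<dots> = F (x + real k * P) + T" using Fper[of "x + real k * P"] by (simp add: T_def)
    finally show ?case using Suc by (simp add: algebra_simps)
  qed simp
  have "\<exists>x. F x = y" for y
  proof -
    obtain k :: nat where k: "\<bar>y - F 0\<bar> < real k * T" using reals_Archimedean3[OF T] by blast
    have "F (- (real k * P)) = F 0 - real k * T" using Fk[of "- (real k * P)" k] by simp
    moreover have "F (real k * P) = F 0 + real k * T" using Fk[of 0 k] by simp
    ultimately have "F (- (real k * P)) \<le> y" "y \<le> F (real k * P)" using k by linarith+
    moreover have "- (real k * P) \<le> real k * P" using P by simp
    ultimately show ?thesis
      using IVT[of F "- (real k * P)" y "real k * P"] DERIV_isCont[OF F] by blast
  qed
  then have surjF: "surj F" by (metis surjI surj_def)
  define \<theta> where "\<theta> = inv F"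
  have inv1: "F (\<theta> t) = t" for t using surjF by (simp add: \<theta>_def surj_f_inv_f)
  have inv2: "\<theta> (F x) = x" for x using strict_mono_imp_inj_on[OF mono] by (simp add: \<theta>_def)
  have "isCont \<theta> (F x)" for x
    by (rule isCont_inverse_function[where d=1]) (auto simp: inv2 DERIV_isCont[OF F])
  then have cont\<theta>: "isCont \<theta> t" for t by (metis inv1)
  have "(\<theta> has_real_derivative w (\<theta> t)) (at t)" for t
    using DERIV_inverse_function[OF F, of \<theta> t "t - 1" "t + 1"] pos[of "\<theta> t"] inv1 cont\<theta>
    by auto
  moreover have "\<theta> (t + T) = \<theta> t + P" for t
    using Fk[of "\<theta> t" 1] inv1[of t] inv2[of "\<theta> t + P"] by simp
  moreover have "surj \<theta>" using inv2 by (metis surjI)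
  ultimately show thesis using that T by blast
qed

section \<open>The oval of a level above the minimum\<close>

text \<open>
  The two equations say that both partial derivatives of \<open>V\<close> vanish at \<open>(x, y)\<close>.
\<close>

locale unique_equilibrium =
  fixes a b c d e f p :: real
  assumes pos: "a > 0" "b > 0" "c > 0" "d > 0" "e > 0" "f > 0" and p: "p > 0"
    and crit: "\<And>x y. x > 0 \<Longrightarrow> y > 0 \<Longrightarrow>
        y\<^sup>2 = ((f + x) * (a + b * x)) / (d * x + e) \<Longrightarrow>
        x\<^sup>2 = ((a + y) * (f + e * y)) / (b + c * y) \<Longrightarrow> x = p"
begin

definition radicand where "radicand x = (e + d * x) * ((f + x) * (a + b * x))"

definition radicand' where
  "radicand' x = d * ((f + x) * (a + b * x)) + (e + d * x) * (a + b * f + 2 * b * x)"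

text \<open>
  The minimum of \<open>V(x, y)\<close> over \<open>y > 0\<close> for fixed \<open>x\<close>. As a function of \<open>y\<close>, \<open>x V\<close> is
  \<open>(e + d x) y + (f + x)(a + b x)/y\<close> plus a constant, and the first
  two terms have minimum \<open>2 sqrt (radicand x)\<close>.
\<close>

definition trough where "trough x = (f + a * e + c * x\<^sup>2 + 2 * sqrt (radicand x)) / x"

definition trough' where
  "trough' x = ((2 * c * x + radicand' x / sqrt (radicand x)) * x
     - (f + a * e + c * x\<^sup>2 + 2 * sqrt (radicand x))) / (x * x)"

lemma radicand_pos: "x > 0 \<Longrightarrow> radicand x > 0"
  unfolding radicand_def using pos by (intro mult_pos_pos add_pos_pos) auto

lemma DERIV_sqrt_radicand:
  assumes "x > 0"
  shows "((\<lambda>x. sqrt (radicand x)) has_real_derivative radicand' x / (2 * sqrt (radicand x))) (at x)"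
proof -
  have "(radicand has_real_derivative radicand' x) (at x)"
    unfolding radicand_def [abs_def] radicand'_def
    by (auto intro!: derivative_eq_intros simp: algebra_simps)
  from DERIV_chain2[OF DERIV_real_sqrt[OF radicand_pos[OF assms]] this]
  show ?thesis by (simp add: field_simps)
qed

lemma DERIV_trough:
  assumes "x > 0"
  shows "(trough has_real_derivative trough' x) (at x)"
  unfolding trough_def [abs_def] trough'_def
  by (rule derivative_eq_intros DERIV_sqrt_radicand assms refl | use assms in simp)+

text \<open>
  A critical point of the minimum over \<open>y\<close>, together with the minimizing
  \<open>y = sqrt (radicand x) / (e + d x)\<close>, is a critical point of \<open>V\<close>.
\<close>

lemma trough_crit:
  assumes x: "x > 0" and z: "trough' x = 0"
  shows "x = p"
proof -
  define A where "A = e + d * x"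
  define r where "r = sqrt (radicand x)"
  define y where "y = r / A"
  define C where "C = (f + x) * (a + b * x)"
  have A: "A > 0" using pos x by (simp add: A_def add_pos_pos)
  have r: "r > 0" "r\<^sup>2 = A * C"
    using radicand_pos[OF x] by (auto simp: r_def A_def C_def radicand_def)
  have y: "y > 0" "r = A * y" using A r by (auto simp: y_def)
  have "A * (A * y\<^sup>2) = A * C" using r(2) unfolding y(2) by (simp add: power2_eq_square ac_simps)
  then have yC: "A * y\<^sup>2 = C" using A by simp
  have "(2 * c * x + radicand' x / r) * x = f + a * e + c * x\<^sup>2 + 2 * r"
    using z x unfolding trough'_def r_def[symmetric] by auto
  moreover have "(2 * c * x + radicand' x / r) * x * r = 2 * c * x\<^sup>2 * r + radicand' x * x"
    using r(1) by (simp add: field_simps power2_eq_square)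
  ultimately have "2 * c * x\<^sup>2 * r + radicand' x * x = (f + a * e + c * x\<^sup>2 + 2 * r) * r"
    by simp
  then have "c * x\<^sup>2 * r + radicand' x * x = (f + a * e) * r + 2 * (A * C)"
    unfolding r(2)[symmetric] by algebra
  then have "A * (c * x\<^sup>2 * y + d * y\<^sup>2 * x + (a + b * f + 2 * b * x) * x)
      = A * ((f + a * e) * y + 2 * C)"
    unfolding radicand'_def y(2) C_def[symmetric] A_def[symmetric] yC[symmetric]
    by algebra
  then have "c * x\<^sup>2 * y + d * y\<^sup>2 * x + (a + b * f + 2 * b * x) * x = (f + a * e) * y + 2 * C"
    using A by simp
  then have "x\<^sup>2 * (b + c * y) = (a + y) * (f + e * y)"
    using yC unfolding A_def C_def by algebra
  moreover have "b + c * y > 0" using pos y by (simp add: add_pos_pos)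
  ultimately have "x\<^sup>2 = ((a + y) * (f + e * y)) / (b + c * y)" by (simp add: field_simps)
  moreover have "y\<^sup>2 = ((f + x) * (a + b * x)) / (d * x + e)"
    using yC A unfolding A_def C_def by (simp add: field_simps)
  ultimately show ?thesis using crit x y(1) by blast
qed

lemma trough_ge: "x > 0 \<Longrightarrow> trough x \<ge> f / x + c * x"
  using radicand_pos[of x] pos by (simp add: trough_def field_simps power2_eq_square)

lemma trough_large_low: "x > 0 \<Longrightarrow> \<exists>y. 0 < y \<and> y < x \<and> trough y > M"
proof -
  assume x: "x > 0"
  define y where "y = min (x / 2) (f / (\<bar>M\<bar> + 1))"
  have y: "0 < y" "y < x" using x pos by (auto simp: y_def min_less_iff_disj)
  have "y \<le> f / (\<bar>M\<bar> + 1)" by (simp add: y_def)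
  then have "\<bar>M\<bar> + 1 \<le> f / y" using y pos by (simp add: field_simps)
  moreover have "c * y > 0" using y pos by simp
  ultimately have "trough y > M" using trough_ge[OF y(1)] by linarith
  then show ?thesis using y by blast
qed

lemma trough_large_high: "x > 0 \<Longrightarrow> \<exists>y. x < y \<and> trough y > M"
proof -
  assume x: "x > 0"
  define y where "y = x + \<bar>M\<bar> / c + 1"
  have "\<bar>M\<bar> / c \<ge> 0" using pos by simp
  then have y: "x < y" "0 < y" using x by (auto simp: y_def intro: add_nonneg_pos)
  have "f / y > 0" using y pos by simp
  moreover have "c * y = c * x + \<bar>M\<bar> + c" using pos by (simp add: y_def field_simps)
  moreover have "c * x > 0" using x pos by simp
  ultimately have "trough y > M" using trough_ge[OF y(2)] pos by linarith
  then show ?thesis using y by blast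
qed

lemma trough'_sign:
  assumes "x > 0"
  shows "x < p \<Longrightarrow> trough' x < 0" "p < x \<Longrightarrow> trough' x > 0"
  using valley_deriv_sign[OF DERIV_trough _ trough_large_low trough_large_high assms] trough_crit
  by blast+

lemma trough_cont: "u > 0 \<Longrightarrow> continuous_on {u..v} trough"
  by (auto intro!: continuous_at_imp_continuous_on DERIV_isCont[OF DERIV_trough])

lemma trough_decreasing: "0 < x \<Longrightarrow> x < y \<Longrightarrow> y \<le> p \<Longrightarrow> trough y < trough x"
  by (rule DERIV_neg_imp_decreasing_open[OF _ _ trough_cont])
     (auto intro!: exI conjI DERIV_trough trough'_sign)

lemma trough_increasing: "p \<le> x \<Longrightarrow> x < y \<Longrightarrow> trough x < trough y"
  using p by (intro DERIV_pos_imp_increasing_open[OF _ _ trough_cont])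
     (auto intro!: exI conjI DERIV_trough trough'_sign)

lemma trough_minimum: "0 < x \<Longrightarrow> x \<noteq> p \<Longrightarrow> trough p < trough x"
  using trough_decreasing[of x p] trough_increasing[of p x] by linarith

text \<open>
  The trough falls up to \<open>p\<close> and rises afterwards, from and to arbitrarily high values; so above its
  minimum every sublevel set is a compact interval around \<open>p\<close>.
\<close>

lemma trough_sublevel:
  assumes "trough p < h"
  obtains \<alpha> \<beta> where "0 < \<alpha>" "\<alpha> < p" "p < \<beta>" "trough \<alpha> = h" "trough \<beta> = h"
    and "\<And>x. 0 < x \<Longrightarrow> trough x \<le> h \<Longrightarrow> \<alpha> \<le> x \<and> x \<le> \<beta>"
    and "\<And>x. \<alpha> < x \<Longrightarrow> x < \<beta> \<Longrightarrow> trough x < h"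
proof -
  obtain y where y: "0 < y" "y < p" "h < trough y" using trough_large_low[OF p] by blast
  obtain \<alpha> where \<alpha>: "y \<le> \<alpha>" "\<alpha> \<le> p" "trough \<alpha> = h"
    using IVT2'[of trough p h y] trough_cont[OF y(1)] y assms by auto
  obtain z where z: "p < z" "h < trough z" using trough_large_high[OF p] by blast
  obtain \<beta> where \<beta>: "p \<le> \<beta>" "\<beta> \<le> z" "trough \<beta> = h"
    using IVT'[of trough p h z] trough_cont[OF p] z assms by auto
  have ne: "\<alpha> \<noteq> p" "\<beta> \<noteq> p" using assms \<alpha> \<beta> by auto
  show thesis
  proof (rule that)
    show "0 < \<alpha>" "\<alpha> < p" "p < \<beta>" "trough \<alpha> = h" "trough \<beta> = h" using y \<alpha> \<beta> ne by auto
    show "\<alpha> \<le> x \<and> x \<le> \<beta>" if "0 < x" "trough x \<le> h" for x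
      using trough_decreasing[of x \<alpha>] trough_increasing[of \<beta> x] \<alpha> \<beta> that by force
    show "trough x < h" if "\<alpha> < x" "x < \<beta>" for x
    proof (cases "x \<le> p")
      case True
      then show ?thesis using trough_decreasing[of \<alpha> x] \<alpha> y that by auto
    next
      case False
      then show ?thesis using trough_increasing[of x \<beta>] \<beta> that by auto
    qed
  qed
qed

text \<open>
  The excess of the level over the minimum on the vertical line through \<open>x\<close>, written as a square:
  it shows that the level is at least the trough, with equality only at the minimizing \<open>y\<close>.
\<close>

lemma cubic_zero_trough:
  assumes "x > 0" and "lyness_cubic a b c d e f h x y = 0"
  shows "((e + d * x) * y - sqrt (radicand x))\<^sup>2 = (e + d * x) * y * x * (h - trough x)"
proof -
  define r where "r = sqrt (radicand x)"
  have r: "r\<^sup>2 = (e + d * x) * ((f + x) * (a + b * x))"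
    using radicand_pos[OF assms(1)] by (simp add: r_def radicand_def)
  have "x * (h - trough x) = h * x - (f + a * e + c * x\<^sup>2 + 2 * r)"
    using assms(1) by (simp add: trough_def r_def field_simps)
  then show ?thesis
    using r assms(2) unfolding r_def[symmetric] lyness_cubic_def by algebra
qed

lemma cubic_zero_trough_le:
  assumes "x > 0" "y > 0" and "lyness_cubic a b c d e f h x y = 0"
  shows "trough x \<le> h"
proof -
  have "0 < (e + d * x) * y * x" using pos assms by (simp add: add_pos_pos)
  moreover have "0 \<le> (e + d * x) * y * x * (h - trough x)"
    using cubic_zero_trough[OF assms(1,3)] by (metis zero_le_power2)
  ultimately show ?thesis by (metis diff_ge_0_iff_ge zero_le_mult_iff not_le)
qed

lemma minimal_level_singleton:
  assumes "h \<le> trough p" "x > 0" "y > 0" "lyness_cubic a b c d e f h x y = 0"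
  shows "x = p \<and> y = sqrt (radicand p) / (e + d * p)"
proof -
  have "x = p" using trough_minimum[of x] cubic_zero_trough_le[OF assms(2-4)] assms by fastforce
  moreover have "trough p = h" using calculation cubic_zero_trough_le[OF assms(2-4)] assms by simp
  moreover have "e + d * p > 0" using pos p by (simp add: add_pos_pos)
  ultimately show ?thesis using cubic_zero_trough[OF assms(2,4)] by (simp add: field_simps)
qed

text \<open>
  The discriminant of the cubic as a quadratic polynomial in \<open>y\<close>: the level curve is
  \<open>Z\<^sup>2 = discriminant\<close> in the coordinates \<open>x\<close> and \<open>Z = \<partial>P/\<partial>y\<close>.
\<close>

definition discriminant_poly where
  "discriminant_poly h = [:f + a * e, - h, c:]\<^sup>2 - smult 4 ([:e, d:] * ([:f, 1:] * [:a, b:]))"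

lemma poly_discriminant:
  "poly (discriminant_poly h) x = (f + a * e - h * x + c * x\<^sup>2)\<^sup>2 - 4 * radicand x"
  by (simp add: discriminant_poly_def radicand_def power2_eq_square algebra_simps)

lemma poly_pderiv_discriminant:
  "poly (pderiv (discriminant_poly h)) x =
     2 * (f + a * e - h * x + c * x\<^sup>2) * (2 * c * x - h) - 4 * radicand' x"
  by (simp add: discriminant_poly_def radicand'_def pderiv_diff pderiv_smult pderiv_mult
      pderiv_pCons power2_eq_square algebra_simps)

lemma linear_coeff_trough:
  "x > 0 \<Longrightarrow> f + a * e - h * x + c * x\<^sup>2 = x * (trough x - h) - 2 * sqrt (radicand x)"
  by (simp add: trough_def field_simps)

lemma poly_discriminant_trough:
  assumes "x > 0"
  shows "poly (discriminant_poly h) x = x * (trough x - h) * (x * (trough x - h) - 4 * sqrt (radicand x))"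
proof -
  define r where "r = sqrt (radicand x)"
  have "radicand x = r\<^sup>2" using radicand_pos[OF assms] by (simp add: r_def)
  moreover have "(k - 2 * r)\<^sup>2 - 4 * r\<^sup>2 = k * (k - 4 * r)" for k by algebra
  ultimately show ?thesis
    unfolding poly_discriminant linear_coeff_trough[OF assms] r_def[symmetric] by simp
qed

text \<open>
  Where the trough meets the level, the discriminant vanishes; the formula shows that this root is
  simple as soon as the trough crosses the level with nonzero slope.
\<close>

lemma poly_pderiv_discriminant_root:
  assumes "x > 0" "trough x = h"
  shows "poly (pderiv (discriminant_poly h)) x = - 4 * x * trough' x * sqrt (radicand x)"
proof (rule DERIV_unique[OF poly_DERIV])
  have "((\<lambda>x. x * (trough x - h) * (x * (trough x - h) - 4 * sqrt (radicand x)))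
      has_real_derivative - 4 * x * trough' x * sqrt (radicand x)) (at x)"
    by (rule derivative_eq_intros DERIV_trough DERIV_sqrt_radicand assms(1) refl
        | simp add: assms(2))+
  then show "(poly (discriminant_poly h) has_real_derivative
      - 4 * x * trough' x * sqrt (radicand x)) (at x)"
    by (rule has_field_derivative_transform_within_open[where S = "{0<..}"])
       (auto simp: poly_discriminant_trough assms)
qed

text \<open>
  Over the sublevel interval of the trough the discriminant is positive inside, with simple
  roots at the ends. The linear coefficient of the cubic is negative on the interval, which will make
  both roots \<open>y\<close> positive.
\<close>

lemma oval_discriminant:
  assumes "trough p < h"
  obtains \<alpha> \<beta> R where "0 < \<alpha>" "\<alpha> < \<beta>"
    and "\<And>x. \<alpha> \<le> x \<Longrightarrow> x \<le> \<beta> \<Longrightarrow> f + a * e - h * x + c * x\<^sup>2 < 0"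
    and "\<And>x y. x > 0 \<Longrightarrow> y > 0 \<Longrightarrow> lyness_cubic a b c d e f h x y = 0 \<Longrightarrow> \<alpha> \<le> x \<and> x \<le> \<beta>"
    and "\<And>x. poly (discriminant_poly h) x = (x - \<alpha>) * (\<beta> - x) * poly R x"
    and "\<And>x. poly (pderiv (discriminant_poly h)) x =
      (\<alpha> + \<beta> - 2 * x) * poly R x + (x - \<alpha>) * (\<beta> - x) * poly (pderiv R) x"
    and "\<And>x. \<alpha> \<le> x \<Longrightarrow> x \<le> \<beta> \<Longrightarrow> poly R x > 0"
proof -
  obtain \<alpha> \<beta> where ab: "0 < \<alpha>" "\<alpha> < p" "p < \<beta>" "trough \<alpha> = h" "trough \<beta> = h"
    and sub: "\<And>x. 0 < x \<Longrightarrow> trough x \<le> h \<Longrightarrow> \<alpha> \<le> x \<and> x \<le> \<beta>"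
    and inner: "\<And>x. \<alpha> < x \<Longrightarrow> x < \<beta> \<Longrightarrow> trough x < h"
    using trough_sublevel[OF assms] by blast
  have \<beta>: "\<beta> > 0" and \<alpha>\<beta>: "\<alpha> < \<beta>" using ab by simp_all
  have D0: "poly (discriminant_poly h) \<alpha> = 0" "poly (discriminant_poly h) \<beta> = 0"
    using ab \<beta> by (simp_all add: poly_discriminant_trough)
  have Dpos: "poly (discriminant_poly h) x > 0" if "\<alpha> < x" "x < \<beta>" for x
  proof -
    have x: "x > 0" using ab that by simp
    have "x * (trough x - h) < 0" using inner[OF that] x by (simp add: mult_less_0_iff)
    moreover have "sqrt (radicand x) > 0" using radicand_pos[OF x] by simp
    ultimately show ?thesis
      unfolding poly_discriminant_trough[OF x] by (intro mult_neg_neg) linarith+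
  qed
  have D': "poly (pderiv (discriminant_poly h)) \<alpha> \<noteq> 0" "poly (pderiv (discriminant_poly h)) \<beta> \<noteq> 0"
    using ab \<beta> trough'_sign(1)[of \<alpha>] trough'_sign(2)[of \<beta>] radicand_pos[of \<alpha>] radicand_pos[of \<beta>]
    by (auto simp: poly_pderiv_discriminant_root)
  have neg: "f + a * e - h * x + c * x\<^sup>2 < 0" if "\<alpha> \<le> x" "x \<le> \<beta>" for x
  proof -
    have x: "x > 0" using that ab by simp
    have "trough x \<le> h" using that ab inner[of x] by (cases "x = \<alpha> \<or> x = \<beta>") auto
    then have "x * (trough x - h) \<le> 0" using x by (simp add: mult_le_0_iff)
    moreover have "sqrt (radicand x) > 0" using radicand_pos[OF x] by simp
    ultimately show ?thesis unfolding linear_coeff_trough[OF x] by linarith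
  qed
  obtain R where R: "\<And>x. poly (discriminant_poly h) x = (x - \<alpha>) * (\<beta> - x) * poly R x"
    "\<And>x. poly (pderiv (discriminant_poly h)) x =
      (\<alpha> + \<beta> - 2 * x) * poly R x + (x - \<alpha>) * (\<beta> - x) * poly (pderiv R) x"
    "\<And>x. \<alpha> \<le> x \<Longrightarrow> x \<le> \<beta> \<Longrightarrow> poly R x > 0"
    using poly_factor_two_roots[OF D0 \<alpha>\<beta> Dpos D'] by blast
  have dom: "\<alpha> \<le> x \<and> x \<le> \<beta>" if "x > 0" "y > 0" "lyness_cubic a b c d e f h x y = 0" for x y
    using sub[OF that(1) cubic_zero_trough_le[OF that]] .
  show thesis by (rule that[OF ab(1) \<alpha>\<beta> neg dom R])
qed

text \<open>
  Above the minimal level the level curve is one periodic Hamiltonian orbit. With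
  \<open>discriminant = (x - \<alpha>)(\<beta> - x) R(x)\<close> and \<open>R > 0\<close>, the oval \<open>Z\<^sup>2 = discriminant\<close> is
  parametrized by an angle through \<open>x = m + \<rho> cos \<theta>\<close>, \<open>Z = \<rho> sin \<theta> sqrt (R x)\<close>,
  where \<open>m\<close> and \<open>\<rho>\<close> are midpoint and half length of \<open>[\<alpha>, \<beta>]\<close>. The Hamiltonian equation
  \<open>x' = - Z\<close> becomes the scalar equation \<open>\<theta>' = sqrt (R x)\<close>, which is regular also at the turning
  points of \<open>x\<close>; this is why the angle is used instead of \<open>x\<close> itself.
\<close>

lemma oval_orbit:
  assumes "trough p < h"
  obtains u v T where "T > 0" "hamiltonian_orbit a b c d e f h u v"
    and "\<And>t. u (t + T) = u t" "\<And>t. v (t + T) = v t"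
    and "\<And>x y. x > 0 \<Longrightarrow> y > 0 \<Longrightarrow> lyness_cubic a b c d e f h x y = 0 \<Longrightarrow> \<exists>t. u t = x \<and> v t = y"
    and "\<exists>t t'. u t \<noteq> u t'"
proof -
  obtain \<alpha> \<beta> R where ab: "0 < \<alpha>" "\<alpha> < \<beta>"
    and neg: "\<And>x. \<alpha> \<le> x \<Longrightarrow> x \<le> \<beta> \<Longrightarrow> f + a * e - h * x + c * x\<^sup>2 < 0"
    and dom: "\<And>x y. x > 0 \<Longrightarrow> y > 0 \<Longrightarrow> lyness_cubic a b c d e f h x y = 0 \<Longrightarrow> \<alpha> \<le> x \<and> x \<le> \<beta>"
    and D: "\<And>x. poly (discriminant_poly h) x = (x - \<alpha>) * (\<beta> - x) * poly R x"
    and D': "\<And>x. poly (pderiv (discriminant_poly h)) x =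
      (\<alpha> + \<beta> - 2 * x) * poly R x + (x - \<alpha>) * (\<beta> - x) * poly (pderiv R) x"
    and R: "\<And>x. \<alpha> \<le> x \<Longrightarrow> x \<le> \<beta> \<Longrightarrow> poly R x > 0"
    using oval_discriminant[OF assms] by blast
  define m where "m = (\<alpha> + \<beta>) / 2"
  define \<rho> where "\<rho> = (\<beta> - \<alpha>) / 2"
  have \<rho>: "\<rho> > 0" using ab by (simp add: \<rho>_def)
  have m\<rho>: "\<alpha> = m - \<rho>" "\<beta> = m + \<rho>" by (simp_all add: m_def \<rho>_def field_simps)
  define X where "X s = m + \<rho> * cos s" for s
  have X: "\<alpha> \<le> X s" "X s \<le> \<beta>" for s
  proof -
    have "\<bar>\<rho> * cos s\<bar> \<le> \<rho>" using \<rho> by (simp add: abs_mult mult_left_le)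
    then show "\<alpha> \<le> X s" "X s \<le> \<beta>" unfolding m\<rho> X_def by linarith+
  qed
  have X_quad: "(X s - \<alpha>) * (\<beta> - X s) = (\<rho> * sin s)\<^sup>2" for s
    unfolding X_def m\<rho> by (simp add: power_mult_distrib sin_squared_eq) (simp add: power2_eq_square algebra_simps)
  define w where "w s = sqrt (poly R (X s))" for s
  have RX: "poly R (X s) > 0" for s using R[OF X] .
  have w: "w s > 0" "(w s)\<^sup>2 = poly R (X s)" for s using RX[of s] by (auto simp: w_def)
  have "isCont w s" for s unfolding w_def X_def by (intro continuous_intros)
  moreover have "w (s + 2 * pi) = w s" for s by (simp add: w_def X_def)
  ultimately obtain \<theta> T where T: "T > 0" and d\<theta>: "\<And>t. (\<theta> has_real_derivative w (\<theta> t)) (at t)"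
    and per: "\<And>t. \<theta> (t + T) = \<theta> t + 2 * pi" and surj: "surj \<theta>"
    using periodic_scalar_flow[of w "2 * pi"] w(1) pi_gt_zero by (metis mult_pos_pos zero_less_numeral)
  define u where "u t = X (\<theta> t)" for t
  define Z where "Z t = \<rho> * sin (\<theta> t) * w (\<theta> t)" for t
  define v where "v t = (Z t - (f + a * e - h * u t + c * (u t)\<^sup>2)) / (2 * (e + d * u t))" for t
  have u: "\<alpha> \<le> u t" "u t \<le> \<beta>" "u t > 0" for t using X[of "\<theta> t"] ab by (auto simp: u_def)
  have A: "e + d * u t > 0" for t using pos u(3)[of t] by (simp add: add_pos_pos)
  have Z2: "(Z t)\<^sup>2 = (f + a * e - h * u t + c * (u t)\<^sup>2)\<^sup>2 - 4 * radicand (u t)" for t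
  proof -
    have "(Z t)\<^sup>2 = (\<rho> * sin (\<theta> t))\<^sup>2 * poly R (u t)"
      by (simp add: Z_def power_mult_distrib w(2) u_def)
    also have "\<dots> = poly (discriminant_poly h) (u t)" using X_quad[of "\<theta> t"] by (simp add: D u_def)
    finally show ?thesis by (simp add: poly_discriminant)
  qed
  have Zv: "Z t = 2 * (e + d * u t) * v t + (f + a * e - h * u t + c * (u t)\<^sup>2)" for t
    using A[of t] by (simp add: v_def)
  have vpos: "v t > 0" for t
  proof -
    have n: "f + a * e - h * u t + c * (u t)\<^sup>2 < 0" using neg u by blast
    have "(Z t)\<^sup>2 < (f + a * e - h * u t + c * (u t)\<^sup>2)\<^sup>2" using Z2 radicand_pos[OF u(3)] by simp
    then have "\<bar>Z t\<bar> < \<bar>f + a * e - h * u t + c * (u t)\<^sup>2\<bar>" 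
      using abs_le_square_iff[of "f + a * e - h * u t + c * (u t)\<^sup>2" "Z t"] by linarith
    then have "Z t - (f + a * e - h * u t + c * (u t)\<^sup>2) > 0" using n by linarith
    then show ?thesis using A[of t] by (simp add: v_def)
  qed
  have zero: "lyness_cubic a b c d e f h (u t) (v t) = 0" for t
  proof -
    have "4 * (e + d * u t) * lyness_cubic a b c d e f h (u t) (v t) = 0"
      using Z2[of t] unfolding Zv lyness_cubic_def radicand_def by algebra
    then show ?thesis using A[of t] by simp
  qed
  have du: "(u has_real_derivative - Z t) (at t)" for t
    unfolding u_def [abs_def] X_def Z_def by (auto intro!: derivative_eq_intros d\<theta>)
  \<comment> \<open>Differentiating \<open>Z\<^sup>2 = discriminant\<close> would give this after division by \<open>Z\<close>, which vanishes
      at the turning points; the factorization gives it everywhere.\<close>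
  have dZ: "(Z has_real_derivative - poly (pderiv (discriminant_poly h)) (u t) / 2) (at t)" for t
  proof -
    have dw: "((\<lambda>t. w (\<theta> t)) has_real_derivative
        poly (pderiv R) (u t) * (- Z t) / (2 * w (\<theta> t))) (at t)"
    proof -
      have "((\<lambda>t. poly R (u t)) has_real_derivative poly (pderiv R) (u t) * (- Z t)) (at t)"
        by (rule DERIV_chain2[OF poly_DERIV du])
      from DERIV_chain2[OF DERIV_real_sqrt this] RX[of "\<theta> t"]
      show ?thesis by (simp add: w_def u_def field_simps)
    qed
    have "(Z has_real_derivative (\<rho> * cos (\<theta> t) * w (\<theta> t)) * w (\<theta> t)
        + \<rho> * sin (\<theta> t) * (poly (pderiv R) (u t) * (- Z t) / (2 * w (\<theta> t)))) (at t)"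
      unfolding Z_def [abs_def]
      by (rule derivative_eq_intros d\<theta> dw[unfolded Z_def] refl | simp)+
    moreover have "(\<rho> * cos (\<theta> t) * w (\<theta> t)) * w (\<theta> t)
        + \<rho> * sin (\<theta> t) * (poly (pderiv R) (u t) * (- Z t) / (2 * w (\<theta> t)))
        = - poly (pderiv (discriminant_poly h)) (u t) / 2"
    proof -
      have "\<rho> * cos (\<theta> t) * w (\<theta> t) * w (\<theta> t) = (u t - m) * poly R (u t)"
        using w(2)[of "\<theta> t"] by (simp add: u_def X_def power2_eq_square)
      moreover have "\<rho> * sin (\<theta> t) * (poly (pderiv R) (u t) * (- Z t) / (2 * w (\<theta> t)))
          = - (\<rho> * sin (\<theta> t))\<^sup>2 * poly (pderiv R) (u t) / 2"
        using w(1)[of "\<theta> t"] by (simp add: Z_def power2_eq_square)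
      ultimately show ?thesis
        unfolding D' X_quad[of "\<theta> t", folded u_def] by (simp add: m_def field_simps)
    qed
    ultimately show ?thesis by simp
  qed
  have "hamiltonian_orbit a b c d e f h u v"
    unfolding hamiltonian_orbit_def
  proof (intro allI conjI)
    fix t
    show "u t > 0" "v t > 0" "lyness_cubic a b c d e f h (u t) (v t) = 0" by (fact u vpos zero)+
    show "(u has_real_derivative - lyness_cubic_dy a b c d e f h (u t) (v t)) (at t)"
      using du[of t] unfolding Zv lyness_cubic_dy_def by (simp add: algebra_simps)
    define v' where "v' = ((- poly (pderiv (discriminant_poly h)) (u t) / 2
        - (- h * (- Z t) + c * (2 * u t * (- Z t)))) * (2 * (e + d * u t))
        - (Z t - (f + a * e - h * u t + c * (u t)\<^sup>2)) * (2 * (d * (- Z t))))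
        / (2 * (e + d * u t) * (2 * (e + d * u t)))"
    have "(v has_real_derivative v') (at t)"
      unfolding v_def [abs_def] v'_def
      by (rule derivative_eq_intros du dZ refl | use A[of t] in simp)+
    moreover have "v' = lyness_cubic_dx a b c d e f h (u t) (v t)"
    proof -
      \<comment> \<open>After \<open>Z\<close> is expressed by \<open>u\<close> and \<open>v\<close>, the difference of both sides is a multiple of the cubic.\<close>
      have "(- poly (pderiv (discriminant_poly h)) (u t) / 2
        - (- h * (- Z t) + c * (2 * u t * (- Z t)))) * (2 * (e + d * u t))
        - (Z t - (f + a * e - h * u t + c * (u t)\<^sup>2)) * (2 * (d * (- Z t)))
        = lyness_cubic_dx a b c d e f h (u t) (v t) * (2 * (e + d * u t) * (2 * (e + d * u t)))"
        using zero[of t] unfolding Zv poly_pderiv_discriminant radicand'_def lyness_cubic_def lyness_cubic_dx_def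
        by algebra
      then show ?thesis using A[of t] unfolding v'_def by simp
    qed
    ultimately show "(v has_real_derivative lyness_cubic_dx a b c d e f h (u t) (v t)) (at t)" by simp
  qed
  moreover have uper: "u (t + T) = u t" for t by (simp add: u_def X_def per)
  moreover have "v (t + T) = v t" for t
    by (simp add: v_def uper Z_def per w_def X_def)
  moreover have "\<exists>t. u t = x \<and> v t = y"
    if xy: "x > 0" "y > 0" "lyness_cubic a b c d e f h x y = 0" for x y
  proof -
    define z where "z = 2 * (e + d * x) * y + (f + a * e - h * x + c * x\<^sup>2)"
    have x: "\<alpha> \<le> x" "x \<le> \<beta>" using dom[OF xy] by auto
    have r: "poly R x > 0" using R[OF x] .
    have "z\<^sup>2 = poly (discriminant_poly h) x"
      using xy(3) unfolding poly_discriminant z_def lyness_cubic_def radicand_def by algebra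
    then have z2: "z\<^sup>2 = (\<rho>\<^sup>2 - (x - m)\<^sup>2) * poly R x"
      unfolding D m\<rho> by (simp add: power2_eq_square algebra_simps)
    have "((x - m) / \<rho>)\<^sup>2 + (z / (\<rho> * sqrt (poly R x)))\<^sup>2 = 1"
      using z2 r \<rho> by (simp add: power_divide power_mult_distrib field_simps)
    then obtain s where s: "(x - m) / \<rho> = cos s" "z / (\<rho> * sqrt (poly R x)) = sin s"
      using sincos_total_2pi by metis
    obtain t where t: "\<theta> t = s" using surj by (metis surjD)
    have ux: "u t = x" using s(1) \<rho> by (simp add: u_def X_def t field_simps)
    then have "Z t = z" using s(2) \<rho> r t by (simp add: Z_def w_def u_def field_simps)
    then have "v t = y" using A[of t] unfolding Zv z_def ux by simp
    then show ?thesis using ux by blast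
  qed
  moreover have "\<exists>t t'. u t \<noteq> u t'"
  proof -
    obtain t t' where "\<theta> t = 0" "\<theta> t' = pi" using surj by (metis surjD)
    then have "u t \<noteq> u t'" using \<rho> by (simp add: u_def X_def)
    then show ?thesis by blast
  qed
  ultimately show thesis using that T by blast
qed

end

section \<open>Irrational rotations and unions of intervals\<close>

lemma periodic_int_shift:
  fixes U :: "real \<Rightarrow> real"
  assumes per: "\<And>t. U (t + T) = U t"
  shows "U (t + of_int j * T) = U t"
proof -
  have pern: "U (t + real n * T) = U t" for t n
  proof (induction n)
    case (Suc n)
    have "U (t + real (Suc n) * T) = U ((t + real n * T) + T)" by (simp add: algebra_simps)
    then show ?case using Suc per by simp
  qed simp
  show ?thesis
  proof (cases "j \<ge> 0")
    case True
    then show ?thesis using pern[of t "nat j"] by simp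
  next
    case False
    then show ?thesis using pern[of "t + of_int j * T" "nat (- j)"] by simp
  qed
qed

lemma rotation_orbit_dense:
  fixes U :: "real \<Rightarrow> real"
  assumes T: "T > 0" and per: "\<And>t. U (t + T) = U t" and cont: "\<And>t. isCont U t"
    and irr: "\<tau> / T \<notin> \<rat>"
  shows "range U \<subseteq> closure (range (\<lambda>k::nat. U (t0 + real k * \<tau>)))"
proof
  fix y assume "y \<in> range U"
  then obtain t where y: "y = U t" by blast
  have peri: "U (r - of_int j * T) = U r" for r j
    using periodic_int_shift[where U = U and T = T and t = r and j = "- j"] per by simp
  show "y \<in> closure (range (\<lambda>k::nat. U (t0 + real k * \<tau>)))"
    unfolding closure_approachable
  proof (intro allI impI)
    fix \<epsilon> :: real assume "\<epsilon> > 0"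
    then obtain \<delta> where \<delta>: "\<delta> > 0" "\<And>s. dist s t < \<delta> \<Longrightarrow> dist (U s) (U t) < \<epsilon>"
      using cont[of t] unfolding continuous_at_eps_delta dist_real_def by blast
    obtain j k :: int where k: "k > 0"
      "\<bar>of_int k * (\<tau> / T) - of_int j - (t - t0) / T\<bar> < \<delta> / T"
      using sequence_of_fractional_parts_is_dense[OF irr, of "\<delta> / T" "(t - t0) / T"] divide_pos_pos[OF \<delta>(1) T]
      by blast
    have "(of_int k * (\<tau> / T) - of_int j - (t - t0) / T) * T
        = (t0 + of_int k * \<tau> - of_int j * T) - t"
      using T by (simp add: field_simps)
    moreover have "\<bar>(of_int k * (\<tau> / T) - of_int j - (t - t0) / T) * T\<bar> < \<delta>"
      using k(2) T by (simp add: abs_mult pos_less_divide_eq)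
    ultimately have "dist (t0 + of_int k * \<tau> - of_int j * T) t < \<delta>" by (simp add: dist_real_def)
    from \<delta>(2)[OF this] have "dist (U (t0 + real (nat k) * \<tau>)) y < \<epsilon>"
      using k(1) by (simp add: peri y)
    then show "\<exists>x\<in>range (\<lambda>k::nat. U (t0 + real k * \<tau>)). dist x y < \<epsilon>" by blast
  qed
qed

text \<open>
  The intervals are the connected components of the union of the pieces. A component contains every
  piece that it meets, and it meets at least one; so there are at most as many components as pieces, and
  none is degenerate.
\<close>

lemma densely_fills_connected_pieces:
  assumes K: "finite K" "card K \<le> k"
    and J: "\<And>i. i \<in> K \<Longrightarrow> connected (J i)" "\<And>i. i \<in> K \<Longrightarrow> J i \<subseteq> {0<..}"
      "\<And>i. i \<in> K \<Longrightarrow> \<exists>y\<in>J i. \<exists>z\<in>J i. y < z"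
    and sub: "x ` {1..} \<subseteq> (\<Union>i\<in>K. J i)" and dense: "\<And>i. i \<in> K \<Longrightarrow> J i \<subseteq> closure (x ` {1..})"
  shows "densely_fills_intervals k x"
proof -
  define S where "S = (\<Union>i\<in>K. J i)"
  have meets: "\<exists>i\<in>K. C = connected_component_set S (SOME y. y \<in> J i) \<and> J i \<subseteq> C"
    if C: "C \<in> components S" for C
  proof -
    obtain y where "y \<in> C" using in_components_nonempty[OF C] by blast
    moreover have "y \<in> S" using calculation in_components_subset[OF C] by blast
    ultimately obtain i where y: "y \<in> C" "i \<in> K" "y \<in> J i" by (auto simp: S_def)
    have JC: "J i \<subseteq> C"
      by (rule components_maximal[OF C J(1)[OF y(2)]]) (use y in \<open>auto simp: S_def\<close>)
    then have "(SOME y. y \<in> J i) \<in> C" using y(3) by (metis someI_ex subsetD)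
    then show ?thesis
      using C JC y(2) by (metis (no_types, lifting) componentsE connected_component_eq)
  qed
  then have im: "components S \<subseteq> (\<lambda>i. connected_component_set S (SOME y. y \<in> J i)) ` K" by blast
  have "finite (components S)" "card (components S) \<le> k"
    using finite_subset[OF im] surj_card_le[OF K(1) im] K by simp_all
  moreover have "disjoint (components S)"
    using pairwise_disjoint_components[of S] by (simp add: pairwise_def disjnt_def)
  moreover have "is_interval C \<and> interior C \<noteq> {} \<and> C \<subseteq> {0<..}" if C: "C \<in> components S" for C
  proof (intro conjI)
    show int: "is_interval C" using in_components_connected[OF C] by (simp add: is_interval_connected_1)
    show "C \<subseteq> {0<..}" using in_components_subset[OF C] J(2) by (auto simp: S_def)
    obtain i where i: "i \<in> K" "J i \<subseteq> C" using meets[OF C] by blast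
    obtain y z where yz: "y \<in> J i" "z \<in> J i" "y < z" using J(3)[OF i(1)] by blast
    then have "y \<in> C" "z \<in> C" using i(2) by auto
    then have "{y..z} \<subseteq> C" using int unfolding is_interval_1 by (meson atLeastAtMost_iff subsetI)
    then have "{y<..<z} \<subseteq> C" by (auto simp: subset_iff)
    then have "{y<..<z} \<subseteq> interior C" by (simp add: interior_maximal)
    then show "interior C \<noteq> {}" using greaterThanLessThan_empty_iff[of y z] yz(3) by auto
  qed
  moreover have "x ` {1..} \<subseteq> \<Union> (components S)" "\<Union> (components S) \<subseteq> closure (x ` {1..})"
    using sub assms(7) by (auto simp: S_def)
  ultimately show ?thesis unfolding densely_fills_intervals_def by blast
qed

section \<open>Periods of solutions and coefficients\<close>

lemma has_period_mult:
  assumes "has_period s p" "q > 0" shows "has_period s (q * p)"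
proof -
  have "s (n + q * p) = s n" if "n \<ge> 1" for n
  proof (induction q)
    case (Suc q)
    have "s (n + Suc q * p) = s ((n + q * p) + p)" by (simp add: algebra_simps)
    then show ?case using Suc that assms(1) by (simp add: has_period_def)
  qed simp
  then show ?thesis using assms by (auto simp: has_period_def)
qed

text \<open>
  Otherwise the remainder \<open>q mod p\<close> would be a smaller period.
\<close>

lemma primitive_period_dvd:
  assumes prim: "has_primitive_period s p" and q: "has_period s q"
  shows "p dvd q"
proof (rule ccontr)
  assume "\<not> p dvd q"
  then have r: "q mod p > 0" by (simp add: dvd_eq_mod_eq_0)
  have p: "has_period s p" "p > 0" using prim by (auto simp: has_primitive_period_def has_period_def)
  have "s (n + q mod p) = s n" if n: "n \<ge> 1" for n
  proof (cases "q div p = 0")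
    case True
    then have "q mod p = q" using div_mult_mod_eq[of q p] by simp
    then show ?thesis using q n by (simp add: has_period_def)
  next
    case False
    then have "has_period s (q div p * p)" using has_period_mult[OF p(1)] by simp
    then have *: "s (m + q div p * p) = s m" if "m \<ge> 1" for m using that by (simp add: has_period_def)
    have "n + q mod p \<ge> 1" using n by simp
    from *[OF this] have "s (n + q mod p) = s ((n + q mod p) + q div p * p)" by (rule sym)
    also have "(n + q mod p) + q div p * p = n + q" by simp
    also have "s (n + q) = s n" using q n by (simp add: has_period_def)
    finally show ?thesis .
  qed
  then have "has_period s (q mod p)" using r by (simp add: has_period_def)
  then have "p \<le> q mod p" using prim by (simp add: has_primitive_period_def)
  then show False using mod_less_divisor[OF p(2), of q] by linarith
qed

lemma primitive_period_exists:
  assumes "has_period s q"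
  obtains p where "has_primitive_period s p"
proof
  show "has_primitive_period s (LEAST p. has_period s p)"
    unfolding has_primitive_period_def using assms by (auto intro: LeastI Least_le)
qed

lemma lyness_sequence_pos:
  assumes s: "\<forall>n\<ge>1. s n > 0" and x: "lyness_sequence s x"
  shows "n \<ge> 1 \<Longrightarrow> x n > 0"
proof -
  have "x (Suc n) > 0 \<and> x (Suc (Suc n)) > 0" for n
  proof (induction n)
    case 0
    then show ?case using x by (simp add: lyness_sequence_def numeral_2_eq_2)
  next
    case (Suc n)
    have "x (Suc n + 2) = (s (Suc n) + x (Suc n + 1)) / x (Suc n)"
      using x by (simp add: lyness_sequence_def)
    moreover have "s (Suc n) > 0" using s by simp
    ultimately show ?case using Suc by simp
  qed
  then show "n \<ge> 1 \<Longrightarrow> x n > 0" by (cases n) auto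
qed

text \<open>
  The coefficients can be read off the solution: \<open>s\<^sub>n = x\<^sub>n x\<^sub>n\<^sub>+\<^sub>2 - x\<^sub>n\<^sub>+\<^sub>1\<close>.
\<close>

lemma coefficient_period_of_solution_period:
  assumes "\<forall>n\<ge>1. s n > 0" "lyness_sequence s x" "has_period x p"
  shows "has_period s p"
proof -
  have rec: "s n = x n * x (n + 2) - x (n + 1)" if "n \<ge> 1" for n
    using assms(2) lyness_sequence_pos[OF assms(1,2) that] that
    by (simp add: lyness_sequence_def)
  have "s (n + p) = s n" if n: "n \<ge> 1" for n
  proof -
    have "x (n + p) = x n" "x (n + 1 + p) = x (n + 1)" "x (n + 2 + p) = x (n + 2)"
      using assms(3) n by (simp_all only: has_period_def)
    then show ?thesis using rec[of n] rec[of "n + p"] n by (simp add: add.commute add.left_commute)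
  qed
  then show ?thesis using assms(3) by (simp add: has_period_def)
qed

lemma lyness_sequence_unique:
  assumes "lyness_sequence s x" "lyness_sequence s y" "x 1 = y 1" "x 2 = y 2"
  shows "n \<ge> 1 \<Longrightarrow> x n = y n"
proof -
  have "x (Suc n) = y (Suc n) \<and> x (Suc (Suc n)) = y (Suc (Suc n))" for n
  proof (induction n)
    case 0
    then show ?case using assms(3,4) by (simp add: numeral_2_eq_2)
  next
    case (Suc n)
    have "x (Suc n + 2) = (s (Suc n) + x (Suc n + 1)) / x (Suc n)"
      "y (Suc n + 2) = (s (Suc n) + y (Suc n + 1)) / y (Suc n)"
      using assms(1,2) by (simp_all add: lyness_sequence_def)
    then show ?case using Suc by simp
  qed
  then show "n \<ge> 1 \<Longrightarrow> x n = y n" by (cases n) auto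
qed

section \<open>Persistence\<close>

lemma has_period_6_representative:
  assumes "has_period s 6" "n \<ge> 1"
  shows "s n = s (1 + (n - 1) mod 6)"
proof -
  have step: "s (m + 6) = s m" if "m \<ge> 1" for m using assms(1) that by (simp add: has_period_def)
  have "s (1 + m + k * 6) = s (1 + m)" for m k
  proof (induction k)
    case (Suc k)
    have "s (1 + m + Suc k * 6) = s ((1 + m + k * 6) + 6)" by (simp add: algebra_simps)
    also have "\<dots> = s (1 + m + k * 6)" by (rule step) simp
    finally show ?case using Suc by simp
  qed simp
  from this[of "(n - 1) mod 6" "(n - 1) div 6"] show ?thesis using assms(2) by simp
qed

lemma lyness_sequence_level:
  assumes s: "\<forall>n\<ge>1. s n > 0" and per: "has_period s 6" and x: "lyness_sequence s x"
  obtains h where "\<And>n. n \<ge> 1 \<Longrightarrow> lyness_cubic (s n) (s (n + 1)) (s (n + 2)) (s (n + 3))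
      (s (n + 4)) (s (n + 5)) h (x n) (x (n + 1)) = 0"
proof
  define h where "h = lyness_cubic (s 1) (s 2) (s 3) (s 4) (s 5) (s 6) 0 (x 1) (x 2) / (x 1 * x 2)"
  show "lyness_cubic (s n) (s (n + 1)) (s (n + 2)) (s (n + 3))
      (s (n + 4)) (s (n + 5)) h (x n) (x (n + 1)) = 0" if "n \<ge> 1" for n
    using that
  proof (induction n rule: nat_induct_at_least)
    case base
    have "0 < x 1 * x 2" using lyness_sequence_pos[OF s x] by simp
    then have "h * (x 1 * x 2) = lyness_cubic (s 1) (s 2) (s 3) (s 4) (s 5) (s 6) 0 (x 1) (x 2)"
      by (rule nonzero_eq_divide_eq[THEN iffD1, OF less_imp_neq[THEN not_sym] h_def])
    then have "lyness_cubic (s 1) (s 2) (s 3) (s 4) (s 5) (s 6) h (x 1) (x 2) = 0"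
      unfolding lyness_cubic_def by algebra
    then show ?case by (simp add: numeral_eq_Suc)
  next
    case (Suc n)
    have "x (n + 2) = (s n + x (n + 1)) / x n" using x Suc by (simp add: lyness_sequence_def)
    moreover have "s (n + 6) = s n" using per Suc by (simp add: has_period_def)
    ultimately show ?case
      using lyness_cubic_step[OF lyness_sequence_pos[OF s x Suc.hyps] Suc.IH]
      by (simp add: numeral_eq_Suc)
  qed
qed

text \<open>
  On the level \<open>h\<close> the summands \<open>s\<^sub>n\<^sub>+\<^sub>2 x\<close> and \<open>s\<^sub>n\<^sub>+\<^sub>5 / x\<close> of the first integral are each
  below \<open>h\<close>.
\<close>

lemma persistent_period_6:
  assumes s: "\<forall>n\<ge>1. s n > 0" and per: "has_period s 6"
  shows "persistent s"
  unfolding persistent_def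
proof (intro allI impI)
  fix x assume x: "lyness_sequence s x"
  obtain h where h: "\<And>n. n \<ge> 1 \<Longrightarrow> lyness_cubic (s n) (s (n + 1)) (s (n + 2)) (s (n + 3))
      (s (n + 4)) (s (n + 5)) h (x n) (x (n + 1)) = 0"
    using lyness_sequence_level[OF s per x] by blast
  have bd: "h > 0" "s (n + 5) < h * x n" "s (n + 2) * x n < h" if n: "n \<ge> 1" for n
    using lyness_cubic_level_bounds[OF _ _ _ _ _ _ _ _ h[OF n]] s lyness_sequence_pos[OF s x] n
    by simp_all
  define \<sigma> where "\<sigma> = Min (s ` {1..6})"
  have \<sigma>: "\<sigma> > 0" using s by (simp add: \<sigma>_def)
  have \<sigma>_le: "\<sigma> \<le> s n" if "n \<ge> 1" for n
  proof -
    have "(n - 1) mod 6 < 6" by simp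
    then have "1 + (n - 1) mod 6 \<in> {1..6}" by auto
    then show ?thesis
      unfolding has_period_6_representative[OF per that] \<sigma>_def by (intro Min_le) auto
  qed
  have h0: "h > 0" using bd(1)[of 1] by simp
  have "\<sigma> / h < x n \<and> x n < h / \<sigma>" if n: "n \<ge> 1" for n
  proof
    show "\<sigma> / h < x n"
      using bd(2)[OF n] \<sigma>_le[of "n + 5"] h0 by (simp add: divide_less_eq mult.commute)
    have "\<sigma> * x n \<le> s (n + 2) * x n"
      using \<sigma>_le[of "n + 2"] lyness_sequence_pos[OF s x n] by (intro mult_right_mono) auto
    then show "x n < h / \<sigma>" using bd(3)[OF n] \<sigma> by (simp add: less_divide_eq mult.commute)
  qed
  then show "\<exists>c0 C0. 0 < c0 \<and> 0 < C0 \<and> (\<forall>n\<ge>1. c0 < x n \<and> x n < C0)"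
    using \<sigma> h0 by (intro exI[of _ "\<sigma> / h"] exI[of _ "h / \<sigma>"]) simp
qed

section \<open>Six steps are a rotation of the oval\<close>

text \<open>
  The solution of the recurrence started at the point \<open>(u t, v t)\<close>, as a function of the phase
  \<open>t\<close>. Index \<open>n\<close> holds the term \<open>x\<^sub>n\<^sub>+\<^sub>1\<close>, whence the shift in the coefficient.
\<close>

fun lyness_curve :: "(nat \<Rightarrow> real) \<Rightarrow> (real \<Rightarrow> real) \<Rightarrow> (real \<Rightarrow> real) \<Rightarrow> nat \<Rightarrow> real \<Rightarrow> real" where
  "lyness_curve s u v 0 t = u t"
| "lyness_curve s u v (Suc 0) t = v t"
| "lyness_curve s u v (Suc (Suc n)) t =
     (s (Suc n) + lyness_curve s u v (Suc n) t) / lyness_curve s u v n t"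

lemma lyness_sequence_eq_curve:
  assumes "lyness_sequence s x" "u t = x 1" "v t = x 2"
  shows "x (Suc n) = lyness_curve s u v n t"
proof -
  have "x (Suc n) = lyness_curve s u v n t \<and> x (Suc (Suc n)) = lyness_curve s u v (Suc n) t"
  proof (induction n)
    case 0
    then show ?case using assms by (simp add: numeral_2_eq_2)
  next
    case (Suc n)
    have "x (Suc n + 2) = (s (Suc n) + x (Suc n + 1)) / x (Suc n)"
      using assms(1) by (simp add: lyness_sequence_def)
    then show ?case using Suc by simp
  qed
  then show ?thesis ..
qed

lemma lyness_curve_orbit:
  assumes s: "\<forall>n\<ge>1. s n > 0" and per: "has_period s 6"
    and orb: "hamiltonian_orbit (s 1) (s 2) (s 3) (s 4) (s 5) (s 6) h u v"
  shows "hamiltonian_orbit (s (n + 1)) (s (n + 2)) (s (n + 3)) (s (n + 4)) (s (n + 5)) (s (n + 6)) h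
     (lyness_curve s u v n) (lyness_curve s u v (Suc n))"
proof (induction n)
  case 0
  then show ?case using orb by (simp add: lyness_curve.simps [abs_def] flip: numeral_2_eq_2)
next
  case (Suc n)
  have "s (n + 1 + 6) = s (n + 1)" using per unfolding has_period_def by (metis le_add2)
  moreover have "s (n + 1) > 0" using s by simp
  ultimately show ?case
    using hamiltonian_orbit_step[OF _ Suc] by (simp add: lyness_curve.simps [abs_def] numeral_eq_Suc)
qed

text \<open>
  Six steps map the level curve to itself and map the Hamiltonian orbit \<open>(u, v)\<close> to another orbit on
  the same curve; by uniqueness that is the same orbit with its time shifted by some \<open>\<tau>\<close>. So in the
  time parameter six steps are the rotation by \<open>\<tau>\<close> of a circle of length \<open>T\<close>. If
  \<open>\<tau>/T\<close> is rational every solution is periodic. If it is irrational, for each residue of the index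
  modulo six the terms are dense in the range of one continuous function of the phase.
\<close>

lemma orbit_dichotomy:
  assumes s: "\<forall>n\<ge>1. s n > 0" and per: "has_period s 6" and x: "lyness_sequence s x"
    and orb: "hamiltonian_orbit (s 1) (s 2) (s 3) (s 4) (s 5) (s 6) h u v"
    and T: "T > 0" "\<And>t. u (t + T) = u t" "\<And>t. v (t + T) = v t"
    and onto: "\<And>y z. y > 0 \<Longrightarrow> z > 0 \<Longrightarrow>
        lyness_cubic (s 1) (s 2) (s 3) (s 4) (s 5) (s 6) h y z = 0 \<Longrightarrow> \<exists>t. u t = y \<and> v t = z"
    and nonconst: "\<exists>t t'. u t \<noteq> u t'"
    and init: "lyness_cubic (s 1) (s 2) (s 3) (s 4) (s 5) (s 6) h (x 1) (x 2) = 0"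
  shows "(\<exists>q. has_period x q) \<or> densely_fills_intervals 6 x"
proof -
  let ?F = "lyness_curve s u v"
  have orbF: "hamiltonian_orbit (s (n + 1)) (s (n + 2)) (s (n + 3)) (s (n + 4)) (s (n + 5)) (s (n + 6)) h
      (?F n) (?F (Suc n))" for n
    by (rule lyness_curve_orbit[OF s per orb])
  have spos: "s 1 > 0" "s 2 > 0" "s 3 > 0" "s 4 > 0" "s 5 > 0" "s 6 > 0" using s by auto
  have s6: "s (n + 6) = s n" if "n \<ge> 1" for n using per that by (simp add: has_period_def)
  have orb6: "hamiltonian_orbit (s 1) (s 2) (s 3) (s 4) (s 5) (s 6) h (?F 6) (?F (Suc 6))"
    using orbF[of 6] s6[of 1] s6[of 2] s6[of 3] s6[of 4] s6[of 5] s6[of 6] by simp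
  obtain \<tau> where \<tau>: "u \<tau> = ?F 6 0" "v \<tau> = ?F (Suc 6) 0"
    using onto[of "?F 6 0" "?F (Suc 6) 0"] orb6 unfolding hamiltonian_orbit_def by blast
  have "hamiltonian_orbit (s 1) (s 2) (s 3) (s 4) (s 5) (s 6) h (\<lambda>t. u (t + \<tau>)) (\<lambda>t. v (t + \<tau>))"
    using orb unfolding hamiltonian_orbit_def by (auto simp flip: DERIV_shift)
  from hamiltonian_orbit_unique[OF spos orb6 this, of 0] \<tau>
  have F6: "?F 6 t = u (t + \<tau>) \<and> ?F (Suc 6) t = v (t + \<tau>)" for t by simp
  have shift: "?F (n + 6) t = ?F n (t + \<tau>) \<and> ?F (Suc n + 6) t = ?F (Suc n) (t + \<tau>)" for n t
  proof (induction n)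
    case 0
    then show ?case using F6[of t] by simp
  next
    case (Suc n)
    have "s (Suc n + 6) = s (Suc n)" by (rule s6) simp
    then show ?case using Suc by (simp only: add_Suc lyness_curve.simps(3))
  qed
  have shiftk: "?F (n + 6 * k) t = ?F n (t + real k * \<tau>)" for n k t
  proof (induction k arbitrary: t)
    case (Suc k)
    have "?F (n + 6 * Suc k) t = ?F ((n + 6 * k) + 6) t" by (simp add: algebra_simps)
    also have "\<dots> = ?F (n + 6 * k) (t + \<tau>)" using shift by blast
    finally show ?case using Suc[of "t + \<tau>"] by (simp add: algebra_simps)
  qed simp
  have Fper: "?F n (t + T) = ?F n t \<and> ?F (Suc n) (t + T) = ?F (Suc n) t" for n t
    by (induction n) (simp_all add: T)
  obtain t0 where t0: "u t0 = x 1" "v t0 = x 2"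
    using onto[OF _ _ init] lyness_sequence_pos[OF s x] by auto
  have xF: "x (Suc n) = ?F n t0" for n by (rule lyness_sequence_eq_curve[where u = u and v = v, OF x t0])
  have xFk: "x (Suc (i + 6 * k)) = ?F i (t0 + real k * \<tau>)" for i k
    unfolding xF by (rule shiftk)
  show ?thesis
  proof (cases "\<tau> / T \<in> \<rat>")
    case True
    then obtain i j :: int where ij: "\<tau> / T = of_int i / of_int j" "j > 0"
      by (metis Rats_cases')
    have "real (nat j) * \<tau> = of_int i * T" using ij T(1) by (simp add: field_simps)
    then have "x (Suc n + 6 * nat j) = x (Suc n)" for n
      using xFk[of n "nat j"] periodic_int_shift[where U = "?F n", of T t0 i] Fper xF[of n]
      by simp
    then have "x (n + 6 * nat j) = x n" if "n \<ge> 1" for n using that by (cases n) auto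
    then have "has_period x (6 * nat j)" using ij(2) by (simp add: has_period_def)
    then show ?thesis by blast
  next
    case False
    have cont: "isCont (?F n) t" for n t
      using orbF[of n] unfolding hamiltonian_orbit_def by (blast intro: DERIV_isCont)
    have Fpos: "?F n t > 0" for n t using orbF[of n] by (simp add: hamiltonian_orbit_def)
    \<comment> \<open>If some term did not depend on the phase, its Hamiltonian equation would be \<open>0 = \<partial>P/\<partial>y\<close>, which
        determines the next term. All later terms would then be constant as well, among them the terms
        with index \<open>6 i\<close>, which are time shifts of \<open>u\<close>; but \<open>u\<close> varies.\<close>
    have noncon: "\<exists>t t'. ?F i t < ?F i t'" for i
    proof (rule ccontr)
      assume no: "\<not> (\<exists>t t'. ?F i t < ?F i t')"
      have "\<exists>c. \<forall>t. ?F (i + n) t = c" for n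
      proof (induction n)
        case 0
        then show ?case using no by (metis add_0_right linorder_less_linear)
      next
        case (Suc n)
        then obtain c where c: "\<And>t. ?F (i + n) t = c" by blast
        define A where "A = 2 * (s (i + n + 5) + s (i + n + 4) * c)"
        define B where "B = s (i + n + 6) + s (i + n + 1) * s (i + n + 5) + s (i + n + 3) * c\<^sup>2 - h * c"
        have "c > 0" using Fpos[of "i + n" 0] c by simp
        then have A: "A > 0" using s by (simp add: A_def add_pos_pos)
        have "?F (Suc (i + n)) t = - B / A" for t
        proof -
          have "(?F (i + n) has_real_derivative - (A * ?F (Suc (i + n)) t + B)) (at t)"
            using orbF[of "i + n"] unfolding hamiltonian_orbit_def lyness_cubic_dy_def A_def B_def c
            by (simp add: algebra_simps)
          moreover have "(?F (i + n) has_real_derivative 0) (at t)"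
            using DERIV_const[of c] c by (metis (no_types, lifting) ext)
          ultimately have "A * ?F (Suc (i + n)) t + B = 0" using DERIV_unique by fastforce
          then show ?thesis using A by (simp add: field_simps)
        qed
        then show ?case by auto
      qed
      from this[of "5 * i"] obtain c where c: "\<And>t. ?F (6 * i) t = c" by auto
      have "u t = c" for t
        using shiftk[of 0 i "t - real i * \<tau>"] c by simp
      then show False using nonconst by simp
    qed
    have "densely_fills_intervals 6 x"
    proof (rule densely_fills_connected_pieces[where K = "{..<6}" and J = "\<lambda>i. range (?F i)"])
      fix i :: nat
      show "connected (range (?F i))"
        using cont by (intro connected_continuous_image continuous_at_imp_continuous_on) auto
      show "range (?F i) \<subseteq> {0<..}" using Fpos by auto
      show "\<exists>y\<in>range (?F i). \<exists>z\<in>range (?F i). y < z" using noncon[of i] by blast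
      have "range (?F i) \<subseteq> closure (range (\<lambda>k::nat. ?F i (t0 + real k * \<tau>)))"
        by (rule rotation_orbit_dense[OF T(1) _ cont False]) (use Fper in blast)
      also have "\<dots> \<subseteq> closure (x ` {1..})"
        by (intro closure_mono) (auto simp flip: xFk)
      finally show "range (?F i) \<subseteq> closure (x ` {1..})" .
    next
      show "x ` {1..} \<subseteq> (\<Union>i\<in>{..<6}. range (?F i))"
      proof
        fix y assume "y \<in> x ` {1..}"
        then obtain n where n: "y = x n" "n \<ge> 1" by auto
        then have "Suc ((n - 1) mod 6 + 6 * ((n - 1) div 6)) = n" by simp
        then have "y = ?F ((n - 1) mod 6) (t0 + real ((n - 1) div 6) * \<tau>)" using xFk n by metis
        then have "y \<in> range (?F ((n - 1) mod 6))" by blast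
        moreover have "(n - 1) mod 6 \<in> {..<6}" by simp
        ultimately show "y \<in> (\<Union>i\<in>{..<6}. range (?F i))" by (rule UN_I[rotated])
      qed
    qed auto
    then show ?thesis ..
  qed
qed

theorem proposition17:
  fixes s :: "nat \<Rightarrow> real" and a b c d e f :: real
  assumes "\<forall>n\<ge>1. s n > 0"
    and "has_primitive_period s 6"
    and "s 1 = a" and "s 2 = b" and "s 3 = c" and "s 4 = d" and "s 5 = e" and "s 6 = f"
  shows "persistent s \<and>
    ((a, b, c, d, e, f) \<in> P_fedcba \<longrightarrow>
      (\<forall>x. lyness_sequence s x \<longrightarrow>
        (\<exists>p. has_primitive_period x p \<and> 6 dvd p) \<or> densely_fills_intervals 6 x))"
proof (intro conjI impI allI)
  note s = assms(1)
  have per: "has_period s 6" using assms(2) by (simp add: has_primitive_period_def)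
  show "persistent s" by (rule persistent_period_6[OF s per])
  fix x assume P: "(a, b, c, d, e, f) \<in> P_fedcba" and x: "lyness_sequence s x"
  define Q where "Q = (\<lambda>(x, y). x > 0 \<and> y > 0 \<and>
        y\<^sup>2 = ((f + x) * (a + b * x)) / (d * x + e) \<and>
        x\<^sup>2 = ((a + y) * (f + e * y)) / (b + c * y))"
  have P': "a > 0 \<and> b > 0 \<and> c > 0 \<and> d > 0 \<and> e > 0 \<and> f > 0 \<and> (\<exists>!z. Q z)"
    using P unfolding P_fedcba_def Q_def by (simp only: mem_Collect_eq case_prod_conv)
  then obtain z where z: "Q z" and zu: "\<And>z'. Q z' \<Longrightarrow> z' = z" by blast
  obtain p q where pq: "z = (p, q)" by (cases z)
  interpret unique_equilibrium a b c d e f p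
  proof
    show "p > 0" using z unfolding pq Q_def by (simp only: case_prod_conv)
    show "x = p" if "x > 0" "y > 0"
        "y\<^sup>2 = ((f + x) * (a + b * x)) / (d * x + e)"
        "x\<^sup>2 = ((a + y) * (f + e * y)) / (b + c * y)" for x y
    proof -
      have "Q (x, y)" unfolding Q_def case_prod_conv using that by (intro conjI)
      then show ?thesis using zu pq by blast
    qed
  qed (use P' in blast)+
  obtain h where level: "\<And>n. n \<ge> 1 \<Longrightarrow> lyness_cubic (s n) (s (n + 1)) (s (n + 2)) (s (n + 3))
      (s (n + 4)) (s (n + 5)) h (x n) (x (n + 1)) = 0"
    using lyness_sequence_level[OF s per x] by blast
  have init: "lyness_cubic a b c d e f h (x 1) (x 2) = 0"
    using level[of 1] assms(3-8) by (simp add: numeral_eq_Suc)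
  have "(\<exists>q. has_period x q) \<or> densely_fills_intervals 6 x"
  proof (cases "trough p < h")
    case True
    obtain u v T where oval: "T > 0" "hamiltonian_orbit a b c d e f h u v"
      "\<And>t. u (t + T) = u t" "\<And>t. v (t + T) = v t"
      "\<And>x y. x > 0 \<Longrightarrow> y > 0 \<Longrightarrow> lyness_cubic a b c d e f h x y = 0 \<Longrightarrow> \<exists>t. u t = x \<and> v t = y"
      "\<exists>t t'. u t \<noteq> u t'" by (rule oval_orbit[OF True]) (rule that)
    show ?thesis
      by (rule orbit_dichotomy[OF s per x, unfolded assms(3-8), OF oval(2,1,3-6) init])
  next
    case False
    \<comment> \<open>The level is minimal, so it consists of one point, which six steps fix.\<close>
    then have h: "h \<le> trough p" by simp
    have s6: "s (n + 6) = s n" if "n \<ge> 1" for n using per that by (simp add: has_period_def)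
    have s': "s 7 = a" "s 8 = b" "s 9 = c" "s 10 = d" "s 11 = e" "s 12 = f"
      using s6[of 1] s6[of 2] s6[of 3] s6[of 4] s6[of 5] s6[of 6] assms(3-8) by simp_all
    have "lyness_cubic a b c d e f h (x 7) (x 8) = 0" using level[of 7] s' by simp
    moreover have "x 1 > 0" "x 2 > 0" "x 7 > 0" "x 8 > 0"
      using lyness_sequence_pos[OF s x] by simp_all
    ultimately have eq: "x 7 = x 1" "x 8 = x 2"
      using minimal_level_singleton[OF h _ _ init] minimal_level_singleton[OF h, of "x 7" "x 8"]
      by metis+
    have "lyness_sequence s (\<lambda>n. x (n + 6))"
      unfolding lyness_sequence_def
    proof (intro conjI allI impI)
      show "x (1 + 6) > 0" "x (2 + 6) > 0" using lyness_sequence_pos[OF s x] by simp_all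
      fix n :: nat assume n: "n \<ge> 1"
      have "x (n + 6 + 2) = (s (n + 6) + x (n + 6 + 1)) / x (n + 6)"
        using x n unfolding lyness_sequence_def by (metis trans_le_add1)
      then show "x (n + 2 + 6) = (s n + x (n + 1 + 6)) / x (n + 6)"
        unfolding s6[OF n] by (simp only: ac_simps)
    qed
    from lyness_sequence_unique[OF this x] eq have "has_period x 6" by (simp add: has_period_def)
    then show ?thesis by blast
  qed
  then show "(\<exists>p. has_primitive_period x p \<and> 6 dvd p) \<or> densely_fills_intervals 6 x"
  proof
    assume "\<exists>q. has_period x q"
    then obtain p where p: "has_primitive_period x p" using primitive_period_exists by blast
    then have "has_period s p"
      using coefficient_period_of_solution_period[OF s x] by (simp add: has_primitive_period_def)
    then have "6 dvd p" by (rule primitive_period_dvd[OF assms(2)])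
    then show ?thesis using p by blast
  qed simp
qed

end
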